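(* Let $k\in\mathbb{N}$ and let $P=(p_n)$ be a basic sequence that is eventually non-decreasing and infinite in limit. (a) If $P$ is $k$-divergent, then there exist a basic sequence $Q=(q_n)$ and a real number $x$ such that: $Q$ is infinite in limit and $k$-divergent; the set $\{n: p_n\ne q_n\}$ has natural density zero; $x$ is $Q$-normal of order $j$ for every $j\in\{1,\dots,k\}$ and $x$ is $Q$-distribution normal; and for every integer $m\ge2$, the number $mx$ is not $Q$-normal of order $j$ for any $j\ge1$. (b) If $P$ is fully divergent, then there exist a basic sequence $Q=(q_n)$ and a real number $x$ such that: $Q$ is infinite in limit and fully divergent; $\{n: p_n\ne q_n\}$ has natural density zero; $x$ is $Q$-normal and $Q$-distribution normal; and for every integer $m\ge2$, the number $mx$ is not $Q$-normal of order $j$ for any $j\ge1$.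
   Context: A basic sequence is a sequence $Q=(q_n)_{n\ge1}$ of integers with $q_n\ge2$; it is infinite in limit if $q_n\to\infty$. The $Q$-Cantor series expansion of a real $x$ is the unique expansion $x=E_0+\sum_{n\ge1}\frac{E_n}{q_1\cdots q_n}$ with $E_0=\lfloor x\rfloor$, $E_n\in\{0,\dots,q_n-1\}$ and $E_n\ne q_n-1$ infinitely often. A block of length $k$ is a $k$-tuple $B=(b_1,\dots,b_k)$ of non-negative integers; $N_n^Q(B,x)$ is the number of $i\le n$ with $E_i=b_1,\dots,E_{i+k-1}=b_k$. Let $Q_n^{(k)}=\sum_{j=1}^n\frac{1}{q_j q_{j+1}\cdots q_{j+k-1}}$. $Q$ is $k$-divergent if $Q_n^{(k)}\to\infty$, and fully divergent if it is $k$-divergent for all $k$. A real $x$ is $Q$-normal of order $k$ if $N_n^Q(B,x)/Q_n^{(k)}\to1$ for every block $B$ of length $k$; $x$ is $Q$-normal if it is $Q$-normal of order $k$ for every $k\ge1$. With $T_{Q,n}(x)=\left(\prod_{j=1}^n q_j\right)x\bmod1$, $x$ is $Q$-distribution normal if $(T_{Q,n}(x))_{n\ge0}$ is uniformly distributed modulo $1$. *)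

theory Defs
  imports "HOL-Analysis.Analysis"
begin

text \<open>Sequences are functions nat => nat; only indices n >= 1 are meaningful.\<close>

definition basic_seq :: "(nat \<Rightarrow> nat) \<Rightarrow> bool" where
  "basic_seq q \<longleftrightarrow> (\<forall>n\<ge>1. 2 \<le> q n)"

definition infinite_in_limit :: "(nat \<Rightarrow> nat) \<Rightarrow> bool" where
  "infinite_in_limit q \<longleftrightarrow> filterlim q at_top sequentially"

definition eventually_nondecreasing :: "(nat \<Rightarrow> nat) \<Rightarrow> bool" where
  "eventually_nondecreasing q \<longleftrightarrow> (\<exists>N. \<forall>n\<ge>N. q n \<le> q (Suc n))"

definition qprod :: "(nat \<Rightarrow> nat) \<Rightarrow> nat \<Rightarrow> nat" where
  "qprod q n = (\<Prod>j\<in>{1..n}. q j)"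

definition T_Q :: "(nat \<Rightarrow> nat) \<Rightarrow> nat \<Rightarrow> real \<Rightarrow> real" where
  "T_Q q n x = frac (real (qprod q n) * x)"

text \<open>The n-th digit E_n (n >= 1) of the Q-Cantor series expansion of x
  (greedy digits; these are exactly the digits of the unique expansion with
  E_n \<noteq> q_n - 1 infinitely often).\<close>
definition cantor_digit :: "(nat \<Rightarrow> nat) \<Rightarrow> real \<Rightarrow> nat \<Rightarrow> nat" where
  "cantor_digit q x n = nat \<lfloor>real (q n) * T_Q q (n - 1) x\<rfloor>"

definition block_count :: "(nat \<Rightarrow> nat) \<Rightarrow> nat list \<Rightarrow> real \<Rightarrow> nat \<Rightarrow> nat" where
  "block_count q B x n =
     card {i \<in> {1..n}. \<forall>t < length B. cantor_digit q x (i + t) = B ! t}"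

definition Q_k :: "(nat \<Rightarrow> nat) \<Rightarrow> nat \<Rightarrow> nat \<Rightarrow> real" where
  "Q_k q k n = (\<Sum>j=1..n. 1 / (\<Prod>t<k. real (q (j + t))))"

definition k_divergent :: "(nat \<Rightarrow> nat) \<Rightarrow> nat \<Rightarrow> bool" where
  "k_divergent q k \<longleftrightarrow> filterlim (Q_k q k) at_top sequentially"

definition fully_divergent :: "(nat \<Rightarrow> nat) \<Rightarrow> bool" where
  "fully_divergent q \<longleftrightarrow> (\<forall>k. k_divergent q k)"

definition Q_normal_order :: "(nat \<Rightarrow> nat) \<Rightarrow> nat \<Rightarrow> real \<Rightarrow> bool" where
  "Q_normal_order q k x \<longleftrightarrow>
     (\<forall>B. length B = k \<longrightarrow>
        (\<lambda>n. real (block_count q B x n) / Q_k q k n) \<longlonglongrightarrow> 1)"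

definition Q_normal :: "(nat \<Rightarrow> nat) \<Rightarrow> real \<Rightarrow> bool" where
  "Q_normal q x \<longleftrightarrow> (\<forall>k\<ge>1. Q_normal_order q k x)"

definition unif_distr_mod1 :: "(nat \<Rightarrow> real) \<Rightarrow> bool" where
  "unif_distr_mod1 u \<longleftrightarrow>
     (\<forall>a b. 0 \<le> a \<and> a < b \<and> b \<le> 1 \<longrightarrow>
        (\<lambda>N. real (card {n. n < N \<and> a \<le> frac (u n) \<and> frac (u n) < b}) / real N)
          \<longlonglongrightarrow> b - a)"

definition Q_distribution_normal :: "(nat \<Rightarrow> nat) \<Rightarrow> real \<Rightarrow> bool" where
  "Q_distribution_normal q x \<longleftrightarrow> unif_distr_mod1 (\<lambda>n. T_Q q n x)"

definition density_zero :: "nat set \<Rightarrow> bool" where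
  "density_zero A \<longleftrightarrow>
     (\<lambda>N. real (card (A \<inter> {1..N})) / real N) \<longlonglongrightarrow> 0"

end

theory Submission
  imports Defs "HOL-Probability.Probability" "HOL-Real_Asymp.Real_Asymp"
begin

text \<open>The digits \<open>E n\<close> of \<open>x\<close> are chosen independently and uniformly from \<open>{0, \<dots>, q n - 2}\<close> with the
  few digits removed for which \<open>E n / q n\<close> is within \<open>O(1 / q n)\<close> of a fraction \<open>i / m\<close> with
  \<open>0 < i < m \<le> r n\<close>, where \<open>r n\<close> grows slowly. Almost surely \<open>x\<close> is normal of every order for which \<open>q\<close>
  is divergent, and distribution normal. The removed digits are the only ones that could turn a large
  digit of \<open>x\<close> into a small digit of \<open>m x\<close>: apart from finitely many places, a digit \<open>d < m\<close> of \<open>m x\<close>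
  arises only from a digit \<open>0\<close> of \<open>x\<close>, with \<open>d\<close> being the carry from the following places. So the digits
  \<open>0\<close> and \<open>1\<close> of \<open>m x\<close> together are as frequent as the digit \<open>0\<close> of \<open>x\<close>, and the
  block \<open>1, 0, \<dots>, 0\<close> occurs only finitely often.

  For orders \<open>j\<close> for which \<open>p\<close> is not divergent it suffices to enlarge finitely many terms of \<open>p\<close>:
  this makes \<open>Q_k q j\<close> at most \<open>3/4\<close>, and then no number is normal of order \<open>j\<close>.\<close>

section \<open>A strong law of large numbers for finite-range dependent events\<close>

text \<open>By monotone convergence the pointwise sum of the \<open>f i\<close> has finite integral.
  It is therefore finite almost everywhere, and the terms of a convergent series tend to 0.\<close>

lemma AE_tendsto_0_if_summable_integral:
  fixes f :: "nat \<Rightarrow> 'a \<Rightarrow> real"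
  assumes int: "\<And>i. integrable M (f i)" and nonneg: "\<And>i x. 0 \<le> f i x"
    and sum: "summable (\<lambda>i. \<integral>x. f i x \<partial>M)"
  shows "AE x in M. (\<lambda>i. f i x) \<longlonglongrightarrow> 0"
proof -
  have [measurable]: "f i \<in> borel_measurable M" for i using int by auto
  have "(\<integral>\<^sup>+x. (\<Sum>i. ennreal (f i x)) \<partial>M) = (\<Sum>i. \<integral>\<^sup>+x. ennreal (f i x) \<partial>M)"
    by (rule nn_integral_suminf) auto
  also have "\<dots> = (\<Sum>i. ennreal (\<integral>x. f i x \<partial>M))"
    by (simp add: nn_integral_eq_integral int nonneg)
  also have "\<dots> = ennreal (\<Sum>i. \<integral>x. f i x \<partial>M)"
    by (intro suminf_ennreal2 sum) (auto simp: nonneg)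
  finally have "(\<integral>\<^sup>+x. (\<Sum>i. ennreal (f i x)) \<partial>M) \<noteq> \<infinity>" by simp
  then have "AE x in M. (\<Sum>i. ennreal (f i x)) \<noteq> \<infinity>"
    by (intro nn_integral_noteq_infinite) auto
  then show ?thesis
  proof eventually_elim
    case (elim x)
    then have "summable (\<lambda>i. f i x)"
      by (intro summable_suminf_not_top) (auto simp: nonneg)
    then show ?case by (rule summable_LIMSEQ_zero)
  qed
qed

text \<open>The square expands into covariances of pairs. Pairs at distance at least
  \<open>j\<close> contribute 0. For each \<open>n\<close> at most \<open>2 * j\<close> indices
  \<open>m\<close> remain, each contributing at most \<open>prob (Y n)\<close>.\<close>

lemma (in prob_space) variance_sum_indicator_le:
  fixes Y :: "nat \<Rightarrow> 'a set"
  assumes Y[measurable]: "\<And>n. Y n \<in> events"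
    and indep: "\<And>n m. n + j \<le> m \<Longrightarrow> prob (Y n \<inter> Y m) = prob (Y n) * prob (Y m)"
  shows "(\<integral>\<omega>. ((\<Sum>n=1..N. indicator (Y n) \<omega>) - (\<Sum>n=1..N. prob (Y n)))\<^sup>2 \<partial>M)
          \<le> 2 * real j * (\<Sum>n=1..N. prob (Y n))"
proof -
  have expand: "((\<Sum>n=1..N. indicator (Y n) \<omega>) - (\<Sum>n=1..N. prob (Y n)))\<^sup>2
     = (\<Sum>n=1..N. \<Sum>m=1..N. indicator (Y n \<inter> Y m) \<omega> - prob (Y m) * indicator (Y n) \<omega>
           - prob (Y n) * indicator (Y m) \<omega> + prob (Y n) * prob (Y m))" for \<omega>
    unfolding power2_eq_square sum_subtractf[symmetric] sum_product
    by (intro sum.cong refl) (auto simp: indicator_def algebra_simps)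
  define D where "D = (\<lambda>n m \<omega>. indicator (Y n \<inter> Y m) \<omega> - prob (Y m) * indicator (Y n) \<omega>
           - prob (Y n) * indicator (Y m) \<omega> + prob (Y n) * prob (Y m))"
  have [simp]: "integrable M (indicator A :: 'a \<Rightarrow> real)" if "A \<in> events" for A
    using that by (simp add: integrable_indicator_iff emeasure_eq_measure)
  have D: "integrable M (D n m)" "(\<integral>\<omega>. D n m \<omega> \<partial>M) = prob (Y n \<inter> Y m) - prob (Y n) * prob (Y m)" for n m
    unfolding D_def by (auto simp: prob_space)
  have "(\<integral>\<omega>. ((\<Sum>n=1..N. indicator (Y n) \<omega>) - (\<Sum>n=1..N. prob (Y n)))\<^sup>2 \<partial>M)
      = (\<Sum>n=1..N. \<Sum>m=1..N. prob (Y n \<inter> Y m) - prob (Y n) * prob (Y m))"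
    unfolding expand by (simp add: D prob_space flip: D_def)
  also have "\<dots> \<le> (\<Sum>n=1..N. \<Sum>m=1..N. if m \<in> {Suc n - j..<n + j} then prob (Y n) else 0)"
  proof (intro sum_mono)
    fix n m
    consider "n + j \<le> m" | "m + j \<le> n" | "m \<in> {Suc n - j..<n + j}" by fastforce
    then show "prob (Y n \<inter> Y m) - prob (Y n) * prob (Y m)
        \<le> (if m \<in> {Suc n - j..<n + j} then prob (Y n) else 0)"
    proof cases
      case 1 then show ?thesis using indep[of n m] by auto
    next
      case 2 then show ?thesis using indep[of m n] by (auto simp: Int_commute mult.commute)
    next
      case 3
      have "prob (Y n \<inter> Y m) \<le> prob (Y n)" by (intro finite_measure_mono) auto
      moreover have "0 \<le> prob (Y n) * prob (Y m)" by simp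
      ultimately have "prob (Y n \<inter> Y m) - prob (Y n) * prob (Y m) \<le> prob (Y n)" by linarith
      then show ?thesis using 3 by simp
    qed
  qed
  also have "\<dots> = (\<Sum>n=1..N. real (card ({1..N} \<inter> {Suc n - j..<n + j})) * prob (Y n))"
    by (subst sum.inter_restrict[symmetric]) auto
  also have "\<dots> \<le> (\<Sum>n=1..N. 2 * real j * prob (Y n))"
  proof (intro sum_mono mult_right_mono)
    fix n
    have "card ({1..N} \<inter> {Suc n - j..<n + j}) \<le> card {Suc n - j..<n + j}"
      by (intro card_mono) auto
    also have "\<dots> \<le> 2 * j" by simp
    finally show "real (card ({1..N} \<inter> {Suc n - j..<n + j})) \<le> 2 * real j" by linarith
  qed simp
  finally show ?thesis by (simp add: sum_distrib_left)
qed

text \<open>Along \<open>\<nu>\<close> the values of \<open>\<mu>\<close> are close to consecutive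
  squares, whose ratios tend to 1. Monotonicity of \<open>S\<close> and \<open>\<mu>\<close> then
  squeezes \<open>S N / \<mu> N\<close> between its values at neighbouring points of
  \<open>\<nu>\<close>.\<close>

lemma ratio_tendsto_1_from_subsequence:
  fixes S \<mu> :: "nat \<Rightarrow> real"
  defines "\<nu> \<equiv> \<lambda>i. LEAST N. (real i + 1)\<^sup>2 \<le> \<mu> N"
  assumes S: "mono S" "\<And>N. 0 \<le> S N" and \<mu>: "mono \<mu>" "\<mu> 0 = 0" "\<And>N. \<mu> (Suc N) \<le> \<mu> N + 1"
    and div: "filterlim \<mu> at_top sequentially"
    and sub: "(\<lambda>i. S (\<nu> i) / \<mu> (\<nu> i)) \<longlonglongrightarrow> 1"
  shows "(\<lambda>N. S N / \<mu> N) \<longlonglongrightarrow> 1"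
proof -
  have ex: "\<exists>N. y \<le> \<mu> N" for y
    using filterlim_at_top[THEN iffD1, OF div, rule_format, of y] by (auto simp: eventually_sequentially)
  have lo: "(real i + 1)\<^sup>2 \<le> \<mu> (\<nu> i)" for i
    unfolding \<nu>_def using ex by (rule LeastI_ex)
  have hi: "\<mu> (\<nu> i) \<le> (real i + 1)\<^sup>2 + 1" for i
  proof -
    \<comment> \<open>Since \<open>\<mu> 0 = 0\<close>, the least index is a successor. Its
      predecessor misses the threshold, and one step adds at most 1.\<close>
    have "\<nu> i \<noteq> 0" using lo[of i] \<mu>(2) by (smt (verit) of_nat_0_le_iff zero_less_power)
    then obtain k where k: "\<nu> i = Suc k" using not0_implies_Suc by blast
    then have "\<not> (real i + 1)\<^sup>2 \<le> \<mu> k" unfolding \<nu>_def by (intro not_less_Least) simp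
    then show ?thesis using \<mu>(3)[of k] k by simp
  qed
  \<comment> \<open>The index \<open>i\<close> with
    \<open>(i + 1)^2 \<le> \<mu> N < (i + 2)^2\<close>; the truncated subtraction is exact once
    \<open>\<mu> N \<ge> 1\<close>.\<close>
  define \<iota> where "\<iota> = (\<lambda>N. nat \<lfloor>sqrt (\<mu> N)\<rfloor> - 1)"
  have \<iota>: "filterlim \<iota> at_top sequentially"
  proof -
    have "filterlim (\<lambda>N. sqrt (\<mu> N)) at_top sequentially"
      by (rule filterlim_compose[OF sqrt_at_top div])
    then have "filterlim (\<lambda>N. nat \<lfloor>sqrt (\<mu> N)\<rfloor>) at_top sequentially"
      by (rule filterlim_compose[OF filterlim_compose[OF filterlim_nat_sequentially filterlim_floor_sequentially]])
    then show ?thesis unfolding \<iota>_def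
      by (rule filterlim_compose[OF filterlim_minus_const_nat_at_top])
  qed
  have ev: "eventually (\<lambda>N. 1 \<le> \<mu> N) sequentially" using div by (simp add: filterlim_at_top)
  have between: "(real (\<iota> N) + 1)\<^sup>2 \<le> \<mu> N \<and> \<mu> N < (real (\<iota> N) + 2)\<^sup>2" if "1 \<le> \<mu> N" for N
  proof -
    define s where "s = sqrt (\<mu> N)"
    have s: "s \<ge> 1" "\<mu> N = s\<^sup>2" using that by (auto simp: s_def)
    have "real (\<iota> N) + 1 = of_int \<lfloor>s\<rfloor>" using s(1) unfolding \<iota>_def s_def by (simp add: of_nat_diff le_nat_iff)
    then have "real (\<iota> N) + 1 \<le> s" "s < real (\<iota> N) + 2" by linarith+
    then show ?thesis unfolding s(2) using s(1) power_mono[of "real (\<iota> N) + 1" s 2] power_strict_mono[of s "real (\<iota> N) + 2" 2] by auto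
  qed
  have le: "\<nu> (\<iota> N) \<le> N" "N \<le> \<nu> (Suc (\<iota> N))" if "1 \<le> \<mu> N" for N
  proof -
    show "\<nu> (\<iota> N) \<le> N" unfolding \<nu>_def using between[OF that] by (intro Least_le) simp
    show "N \<le> \<nu> (Suc (\<iota> N))"
    proof (rule ccontr)
      assume "\<not> ?thesis"
      then have "\<mu> (\<nu> (Suc (\<iota> N))) \<le> \<mu> N" by (intro monoD[OF \<mu>(1)]) simp
      with lo[of "Suc (\<iota> N)"] between[OF that] show False by (simp add: add.commute)
    qed
  qed
  define r where "r = (\<lambda>i. S (\<nu> i) / \<mu> (\<nu> i))"
  have \<mu>pos: "\<mu> (\<nu> i) > 0" for i using lo[of i] by (smt (verit) of_nat_0_le_iff zero_less_power)
  have Sr: "S (\<nu> i) = r i * \<mu> (\<nu> i)" for i using \<mu>pos[of i] by (simp add: r_def)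
  have r0: "r i \<ge> 0" for i using \<mu>pos[of i] S(2) by (simp add: r_def)
  \<comment> \<open>Replacing \<open>N\<close> by the point of \<open>\<nu>\<close> below it, or by
    the one above it, costs only a factor tending to 1. The extra 1 in the upper factor comes from
    \<open>hi\<close>.\<close>
  have "(\<lambda>i. (real i + 1)\<^sup>2 / (real i + 2)\<^sup>2) \<longlonglongrightarrow> 1" by real_asymp
  then have "(\<lambda>i. r i * ((real i + 1)\<^sup>2 / (real i + 2)\<^sup>2)) \<longlonglongrightarrow> 1 * 1"
    using sub unfolding r_def by (intro tendsto_mult)
  from filterlim_compose[OF this \<iota>] have low: "(\<lambda>N. r (\<iota> N) * ((real (\<iota> N) + 1)\<^sup>2 / (real (\<iota> N) + 2)\<^sup>2)) \<longlonglongrightarrow> 1"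
    by (simp only: mult_1_right)
  have "(\<lambda>i. ((real i + 2)\<^sup>2 + 1) / (real i + 1)\<^sup>2) \<longlonglongrightarrow> 1" by real_asymp
  then have "(\<lambda>i. r (Suc i) * (((real i + 2)\<^sup>2 + 1) / (real i + 1)\<^sup>2)) \<longlonglongrightarrow> 1 * 1"
    using sub unfolding r_def by (intro tendsto_mult LIMSEQ_Suc)
  from filterlim_compose[OF this \<iota>] have up: "(\<lambda>N. r (Suc (\<iota> N)) * (((real (\<iota> N) + 2)\<^sup>2 + 1) / (real (\<iota> N) + 1)\<^sup>2)) \<longlonglongrightarrow> 1"
    by (simp only: mult_1_right)
  show ?thesis
  proof (rule tendsto_sandwich[OF _ _ low up])
    show "eventually (\<lambda>N. r (\<iota> N) * ((real (\<iota> N) + 1)\<^sup>2 / (real (\<iota> N) + 2)\<^sup>2) \<le> S N / \<mu> N) sequentially"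
      using ev
    proof eventually_elim
      case (elim N)
      have "r (\<iota> N) * (real (\<iota> N) + 1)\<^sup>2 \<le> r (\<iota> N) * \<mu> (\<nu> (\<iota> N))"
        using lo r0 by (intro mult_left_mono)
      also have "\<dots> = S (\<nu> (\<iota> N))" by (simp add: Sr)
      also have "\<dots> \<le> S N" by (intro monoD[OF S(1)] le elim)
      finally have "r (\<iota> N) * (real (\<iota> N) + 1)\<^sup>2 / (real (\<iota> N) + 2)\<^sup>2 \<le> S N / \<mu> N"
        using between[OF elim] elim S(2)[of N] by (intro frac_le) auto
      then show ?case by simp
    qed
    show "eventually (\<lambda>N. S N / \<mu> N \<le> r (Suc (\<iota> N)) * (((real (\<iota> N) + 2)\<^sup>2 + 1) / (real (\<iota> N) + 1)\<^sup>2)) sequentially"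
      using ev
    proof eventually_elim
      case (elim N)
      have "S N \<le> S (\<nu> (Suc (\<iota> N)))" by (intro monoD[OF S(1)] le elim)
      also have "\<dots> = r (Suc (\<iota> N)) * \<mu> (\<nu> (Suc (\<iota> N)))" by (simp add: Sr)
      also have "\<dots> \<le> r (Suc (\<iota> N)) * ((real (\<iota> N) + 2)\<^sup>2 + 1)"
        using hi[of "Suc (\<iota> N)"] r0 by (intro mult_left_mono) (auto simp: add.commute)
      finally have "S N / \<mu> N \<le> r (Suc (\<iota> N)) * ((real (\<iota> N) + 2)\<^sup>2 + 1) / (real (\<iota> N) + 1)\<^sup>2"
        using between[OF elim] r0[of "Suc (\<iota> N)"] by (intro frac_le) auto
      then show ?case by simp
    qed
  qed
qed

text \<open>By the variance bound, the mean square relative error is at most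
  \<open>2 * j / \<mu> N\<close>. Along \<open>\<nu>\<close> this is summable, so the error vanishes
  almost surely there; the preceding lemma fills the gaps.\<close>

lemma (in prob_space) strong_law_finite_range_dependence:
  fixes Y :: "nat \<Rightarrow> 'a set"
  assumes Y[measurable]: "\<And>n. Y n \<in> events"
    and indep: "\<And>n m. n + j \<le> m \<Longrightarrow> prob (Y n \<inter> Y m) = prob (Y n) * prob (Y m)"
    and div: "filterlim (\<lambda>N. \<Sum>n=1..N. prob (Y n)) at_top sequentially"
  shows "AE \<omega> in M. (\<lambda>N. real (card {n \<in> {1..N}. \<omega> \<in> Y n}) / (\<Sum>n=1..N. prob (Y n))) \<longlonglongrightarrow> 1"
proof -
  define \<mu> where "\<mu> = (\<lambda>N. \<Sum>n=1..N. prob (Y n))"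
  define S where "S = (\<lambda>N \<omega>. \<Sum>n=1..N. indicator (Y n) \<omega> :: real)"
  define \<nu> where "\<nu> = (\<lambda>i::nat. LEAST N. (real i + 1)\<^sup>2 \<le> \<mu> N)"
  have "\<exists>N. y \<le> \<mu> N" for y
    using filterlim_at_top[THEN iffD1, OF div, rule_format, of y] by (auto simp: \<mu>_def eventually_sequentially)
  then have lo: "(real i + 1)\<^sup>2 \<le> \<mu> (\<nu> i)" for i
    unfolding \<nu>_def by (rule LeastI_ex)
  have \<mu>pos: "\<mu> (\<nu> i) > 0" for i using lo[of i] by (smt (verit) of_nat_0_le_iff zero_less_power)
  define f where "f = (\<lambda>i \<omega>. ((S (\<nu> i) \<omega> - \<mu> (\<nu> i)) / \<mu> (\<nu> i))\<^sup>2)"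
  have Sle: "\<bar>S N \<omega>\<bar> \<le> real N" for N \<omega>
  proof -
    have "S N \<omega> \<le> (\<Sum>n=1..N. 1)" unfolding S_def by (intro sum_mono) (simp add: indicator_def)
    moreover have "0 \<le> S N \<omega>" by (simp add: S_def sum_nonneg)
    ultimately show ?thesis by simp
  qed
  have intS: "integrable M (\<lambda>\<omega>. (S N \<omega> - c)\<^sup>2)" for N c
  proof (rule integrable_const_bound[where B = "(real N + \<bar>c\<bar>)\<^sup>2"])
    show "AE \<omega> in M. norm ((S N \<omega> - c)\<^sup>2) \<le> (real N + \<bar>c\<bar>)\<^sup>2"
    proof (rule AE_I2)
      fix \<omega>
      have "\<bar>S N \<omega> - c\<bar> \<le> real N + \<bar>c\<bar>" using Sle[of N \<omega>] by linarith
      then show "norm ((S N \<omega> - c)\<^sup>2) \<le> (real N + \<bar>c\<bar>)\<^sup>2"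
        by (simp add: abs_le_square_iff[symmetric])
    qed
  qed (simp add: S_def)
  have fint: "integrable M (f i)" for i
    unfolding f_def power_divide by (intro integrable_divide_zero intS)
  have fle: "(\<integral>\<omega>. f i \<omega> \<partial>M) \<le> 2 * real j * (1 / (real i + 1)\<^sup>2)" for i
  proof -
    have "(\<integral>\<omega>. f i \<omega> \<partial>M) = (\<integral>\<omega>. (S (\<nu> i) \<omega> - \<mu> (\<nu> i))\<^sup>2 \<partial>M) / (\<mu> (\<nu> i))\<^sup>2"
      unfolding f_def power_divide by simp
    also have "\<dots> \<le> (2 * real j * \<mu> (\<nu> i)) / (\<mu> (\<nu> i))\<^sup>2"
      unfolding S_def \<mu>_def by (intro divide_right_mono variance_sum_indicator_le Y indep) auto
    also have "\<dots> = 2 * real j * (1 / \<mu> (\<nu> i))" using \<mu>pos[of i] by (simp add: power2_eq_square)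
    also have "\<dots> \<le> 2 * real j * (1 / (real i + 1)\<^sup>2)"
      using lo[of i] \<mu>pos[of i] by (intro mult_left_mono frac_le) auto
    finally show ?thesis .
  qed
  have "summable (\<lambda>i. 1 / (real i + 1)\<^sup>2)"
    using summable_Suc_iff[of "\<lambda>i. inverse (real i ^ 2)"] inverse_power_summable[of 2, where 'a = real]
    by (simp add: inverse_eq_divide add.commute)
  then have "summable (\<lambda>i. 2 * real j * (1 / (real i + 1)\<^sup>2))" by (rule summable_mult)
  then have "summable (\<lambda>i. \<integral>\<omega>. f i \<omega> \<partial>M)"
    by (rule summable_comparison_test'[where N = 0])
       (use fle in \<open>auto simp: f_def integral_nonneg_AE\<close>)
  then have "AE \<omega> in M. (\<lambda>i. f i \<omega>) \<longlonglongrightarrow> 0"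
    by (intro AE_tendsto_0_if_summable_integral fint) (auto simp: f_def)
  then show ?thesis
  proof eventually_elim
    case (elim \<omega>)
    have "(\<lambda>i. sqrt (f i \<omega>)) \<longlonglongrightarrow> 0" using tendsto_real_sqrt[OF elim] by simp
    then have "(\<lambda>i. (S (\<nu> i) \<omega> - \<mu> (\<nu> i)) / \<mu> (\<nu> i)) \<longlonglongrightarrow> 0"
      by (simp add: f_def tendsto_rabs_zero_iff del: abs_divide)
    then have "(\<lambda>i. (S (\<nu> i) \<omega> - \<mu> (\<nu> i)) / \<mu> (\<nu> i) + 1) \<longlonglongrightarrow> 0 + 1"
      by (intro tendsto_add tendsto_const)
    moreover have "(S (\<nu> i) \<omega> - \<mu> (\<nu> i)) / \<mu> (\<nu> i) + 1 = S (\<nu> i) \<omega> / \<mu> (\<nu> i)" for i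
      using \<mu>pos[of i] by (simp add: field_simps)
    ultimately have sub: "(\<lambda>i. S (\<nu> i) \<omega> / \<mu> (\<nu> i)) \<longlonglongrightarrow> 1" by simp
    have "(\<lambda>N. S N \<omega> / \<mu> N) \<longlonglongrightarrow> 1"
    proof (rule ratio_tendsto_1_from_subsequence)
      show "mono (\<lambda>N. S N \<omega>)" "mono \<mu>"
        unfolding S_def \<mu>_def by (intro monoI sum_mono2; auto)+
      show "\<mu> (Suc N) \<le> \<mu> N + 1" for N by (simp add: \<mu>_def)
    qed (use sub div in \<open>auto simp: \<nu>_def \<mu>_def S_def sum_nonneg\<close>)
    moreover have "S N \<omega> = real (card {n \<in> {1..N}. \<omega> \<in> Y n})" for N
      unfolding S_def by (simp add: indicator_def sum.If_cases Int_def)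
    ultimately show ?case by (simp add: \<mu>_def)
  qed
qed

section \<open>Generic points in a product of finite uniform spaces\<close>

text \<open>Here \<open>\<pi> k n\<close> is the probability that a random sequence satisfies
  constraint \<open>k\<close> on the window of length \<open>j k\<close> starting at
  \<open>n\<close>. Disjoint windows are independent, so the strong law applies to each
  \<open>k\<close>. Countability of the index type gives one \<open>\<omega>\<close> good for all
  \<open>k\<close> at once.\<close>

lemma exists_generic_sequence:
  fixes A :: "nat \<Rightarrow> nat set" and j :: "'i::countable \<Rightarrow> nat" and C :: "'i \<Rightarrow> nat \<Rightarrow> nat \<Rightarrow> nat set"
  defines "\<pi> \<equiv> \<lambda>k n. \<Prod>t<j k. real (card (A (n + t) \<inter> C k n t)) / real (card (A (n + t)))"
  assumes A: "\<And>n. finite (A n)" "\<And>n. A n \<noteq> {}"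
  shows "\<exists>\<omega>. (\<forall>n. \<omega> n \<in> A n) \<and>
     (\<forall>k. filterlim (\<lambda>N. \<Sum>n=1..N. \<pi> k n) at_top sequentially \<longrightarrow>
        (\<lambda>N. real (card {n \<in> {1..N}. \<forall>t<j k. \<omega> (n + t) \<in> C k n t}) / (\<Sum>n=1..N. \<pi> k n)) \<longlonglongrightarrow> 1)"
proof -
  define M where "M = (\<lambda>n. uniform_count_measure (A n))"
  have ps: "prob_space (M n)" for n unfolding M_def by (intro prob_space_uniform_count_measure A)
  interpret product_prob_space M UNIV
    by (intro product_prob_spaceI ps)
  define \<Omega> where "\<Omega> = PiM UNIV M"
  have cyl: "P.prob {\<omega> \<in> space \<Omega>. \<forall>i\<in>J. \<omega> i \<in> X i} = (\<Prod>i\<in>J. real (card (A i \<inter> X i)) / real (card (A i)))"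
    if "finite J" for J X
  proof -
    have mem: "\<omega> i \<in> A i" if "\<omega> \<in> space \<Omega>" for \<omega> i
      using that by (auto simp: \<Omega>_def space_PiM M_def space_uniform_count_measure)
    \<comment> \<open>Intersecting with \<open>A i\<close> changes nothing on
      \<open>space \<Omega>\<close> and makes arbitrary constraint sets measurable.\<close>
    have "emeasure \<Omega> {\<omega> \<in> space \<Omega>. \<forall>i\<in>J. \<omega> i \<in> X i} = emeasure \<Omega> {\<omega> \<in> space \<Omega>. \<forall>i\<in>J. \<omega> i \<in> A i \<inter> X i}"
      using mem by (intro arg_cong[where f = "emeasure \<Omega>"]) auto
    also have "\<dots> = (\<Prod>i\<in>J. emeasure (M i) (A i \<inter> X i))"
      unfolding \<Omega>_def by (intro emeasure_PiM_Collect that) (auto simp: M_def sets_uniform_count_measure)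
    also have "\<dots> = (\<Prod>i\<in>J. ennreal (real (card (A i \<inter> X i)) / real (card (A i))))"
      unfolding M_def using A by (intro prod.cong refl emeasure_uniform_count_measure) auto
    also have "\<dots> = ennreal (\<Prod>i\<in>J. real (card (A i \<inter> X i)) / real (card (A i)))"
      by (intro prod_ennreal) auto
    finally show ?thesis
      unfolding \<Omega>_def by (simp add: measure_def prod_nonneg)
  qed
  define Y where "Y = (\<lambda>k n. {\<omega> \<in> space \<Omega>. \<forall>t<j k. \<omega> (n + t) \<in> C k n t})"
  \<comment> \<open>Indexing by absolute position turns the event into a cylinder, to which
    \<open>cyl\<close> applies.\<close>
  have Y_alt: "Y k n = {\<omega> \<in> space \<Omega>. \<forall>i\<in>{n..<n + j k}. \<omega> i \<in> C k n (i - n)}" for k n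
  proof -
    have "(\<forall>t<j k. \<omega> (n + t) \<in> C k n t) \<longleftrightarrow> (\<forall>i\<in>{n..<n + j k}. \<omega> i \<in> C k n (i - n))" for \<omega>
    proof (intro iffI ballI allI impI)
      fix i assume H: "\<forall>t<j k. \<omega> (n + t) \<in> C k n t" and i: "i \<in> {n..<n + j k}"
      then have "i - n < j k" "n + (i - n) = i" by auto
      with H show "\<omega> i \<in> C k n (i - n)" by metis
    next
      fix t assume "\<forall>i\<in>{n..<n + j k}. \<omega> i \<in> C k n (i - n)" "t < j k"
      then show "\<omega> (n + t) \<in> C k n t" by (auto dest: bspec[of _ _ "n + t"])
    qed
    then show ?thesis by (simp add: Y_def)
  qed
  have shift: "(\<Prod>i\<in>{n..<n + j k}. f i (i - n)) = (\<Prod>t<j k. f (n + t) t)" for f :: "nat \<Rightarrow> nat \<Rightarrow> real" and n k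
    by (rule prod.reindex_bij_witness[where i = "\<lambda>t. n + t" and j = "\<lambda>i. i - n"]) auto
  have probY: "P.prob (Y k n) = \<pi> k n" for k n
    unfolding Y_alt \<pi>_def cyl[OF finite_atLeastLessThan]
    by (rule shift[of "\<lambda>i t. real (card (A i \<inter> C k n t)) / real (card (A i))"])
  have Ymeas: "Y k n \<in> P.events" for k n
  proof -
    have "Y k n = {\<omega> \<in> space (PiM UNIV M). \<forall>i\<in>{n..<n + j k}. \<omega> i \<in> A i \<inter> C k n (i - n)}"
      unfolding Y_alt \<Omega>_def by (auto simp: space_PiM M_def space_uniform_count_measure)
    also have "\<dots> \<in> P.events"
      by (intro sets.sets_Collect_finite_All sets_Collect_single) (auto simp: M_def sets_uniform_count_measure)
    finally show ?thesis .
  qed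
  have Yindep: "P.prob (Y k n \<inter> Y k m) = P.prob (Y k n) * P.prob (Y k m)" if "n + j k \<le> m" for k n m
  proof -
    \<comment> \<open>The two windows are disjoint, so their constraints merge into a single family
      and the intersection is again a cylinder.\<close>
    define X where "X = (\<lambda>i. if i < n + j k then C k n (i - n) else C k m (i - m))"
    define f where "f = (\<lambda>i. real (card (A i \<inter> X i)) / real (card (A i)))"
    have "Y k n \<inter> Y k m = {\<omega> \<in> space \<Omega>. \<forall>i\<in>{n..<n + j k} \<union> {m..<m + j k}. \<omega> i \<in> X i}"
      unfolding Y_alt X_def using that by (auto simp: ball_Un)
    then have "P.prob (Y k n \<inter> Y k m) = (\<Prod>i\<in>{n..<n + j k} \<union> {m..<m + j k}. f i)"
      by (simp add: cyl f_def)
    also have "\<dots> = (\<Prod>i\<in>{n..<n + j k}. f i) * (\<Prod>i\<in>{m..<m + j k}. f i)"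
      using that by (intro prod.union_disjoint) auto
    also have "(\<Prod>i\<in>{n..<n + j k}. f i) = P.prob (Y k n)"
      unfolding Y_alt cyl[OF finite_atLeastLessThan] f_def X_def by (intro prod.cong) auto
    also have "(\<Prod>i\<in>{m..<m + j k}. f i) = P.prob (Y k m)"
      unfolding Y_alt cyl[OF finite_atLeastLessThan] f_def X_def using that by (intro prod.cong) auto
    finally show ?thesis .
  qed
  have "AE \<omega> in \<Omega>. filterlim (\<lambda>N. \<Sum>n=1..N. \<pi> k n) at_top sequentially \<longrightarrow>
        (\<lambda>N. real (card {n \<in> {1..N}. \<omega> \<in> Y k n}) / (\<Sum>n=1..N. \<pi> k n)) \<longlonglongrightarrow> 1" for k
    using P.strong_law_finite_range_dependence[of "Y k", OF Ymeas Yindep] unfolding probY \<Omega>_def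
    by (cases "filterlim (\<lambda>N. \<Sum>n=1..N. \<pi> k n) at_top sequentially") simp_all
  then have "AE \<omega> in \<Omega>. \<forall>k. filterlim (\<lambda>N. \<Sum>n=1..N. \<pi> k n) at_top sequentially \<longrightarrow>
        (\<lambda>N. real (card {n \<in> {1..N}. \<omega> \<in> Y k n}) / (\<Sum>n=1..N. \<pi> k n)) \<longlonglongrightarrow> 1"
    by (simp add: AE_all_countable)
  moreover have "AE \<omega> in \<Omega>. \<omega> \<in> space \<Omega>" by simp
  ultimately have "AE \<omega> in \<Omega>. \<omega> \<in> space \<Omega> \<and> (\<forall>k. filterlim (\<lambda>N. \<Sum>n=1..N. \<pi> k n) at_top sequentially \<longrightarrow>
        (\<lambda>N. real (card {n \<in> {1..N}. \<omega> \<in> Y k n}) / (\<Sum>n=1..N. \<pi> k n)) \<longlonglongrightarrow> 1)"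
    by eventually_elim simp
  then obtain \<omega> where \<omega>: "\<omega> \<in> space \<Omega>" and lim: "\<And>k. filterlim (\<lambda>N. \<Sum>n=1..N. \<pi> k n) at_top sequentially \<longrightarrow>
        (\<lambda>N. real (card {n \<in> {1..N}. \<omega> \<in> Y k n}) / (\<Sum>n=1..N. \<pi> k n)) \<longlonglongrightarrow> 1"
    using eventually_happens'[OF P.ae_filter_bot[folded \<Omega>_def]] by blast
  show ?thesis
  proof (intro exI[of _ \<omega>] conjI allI)
    show "\<omega> n \<in> A n" for n using \<omega> by (auto simp: \<Omega>_def space_PiM M_def space_uniform_count_measure)
    show "filterlim (\<lambda>N. \<Sum>n=1..N. \<pi> k n) at_top sequentially \<longrightarrow>
        (\<lambda>N. real (card {n \<in> {1..N}. \<forall>t<j k. \<omega> (n + t) \<in> C k n t}) / (\<Sum>n=1..N. \<pi> k n)) \<longlonglongrightarrow> 1" for k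
      using lim[of k] \<omega> by (simp add: Y_def)
  qed
qed

section \<open>Digits of Cantor series and of integer multiples\<close>

lemma frac_of_int_mult_frac: "frac (of_int a * frac y) = frac (of_int a * y :: real)"
proof -
  have "of_int a * y = of_int a * frac y + of_int (a * \<lfloor>y\<rfloor>)"
    by (simp add: frac_def algebra_simps)
  then show ?thesis by (simp only: frac_def floor_add_int[symmetric])
qed

lemma T_Q_of_int_mult: "T_Q q n (of_int m * x) = frac (of_int m * T_Q q n x)"
  unfolding T_Q_def frac_of_int_mult_frac by (simp add: mult.left_commute)

lemma T_Q_Suc: "T_Q q (Suc n) x = frac (real (q (Suc n)) * T_Q q n x)"
  using frac_of_int_mult_frac[of "int (q (Suc n))" "real (qprod q n) * x"]
  by (simp add: T_Q_def qprod_def mult_ac)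

lemma T_Q_bounds: "0 \<le> T_Q q n x" "T_Q q n x < 1"
  by (auto simp: T_Q_def frac_lt_1)

text \<open>Splits the scaled remainder into integer part and fractional part; every later digit
  argument starts from this recursion.\<close>

lemma T_Q_digit:
  "real (q (Suc n)) * T_Q q n x = real (cantor_digit q x (Suc n)) + T_Q q (Suc n) x"
  using T_Q_bounds[of q n x] unfolding T_Q_Suc by (simp add: cantor_digit_def frac_def)

text \<open>The number is the value \<open>R 0\<close> of the Cantor series, and \<open>R n\<close>
  is the series of its digits after place \<open>n\<close>, rescaled. Once
  \<open>0 \<le> R n < 1\<close> is known, the recursion \<open>rec\<close> identifies
  \<open>R n\<close> with \<open>T_Q q n (R 0)\<close> and hence yields the digits.\<close>

lemma exists_cantor_digits:
  fixes q E :: "nat \<Rightarrow> nat"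
  assumes q: "\<And>n. 2 \<le> q n" and E: "\<And>n. E n + 2 \<le> q n"
  shows "\<exists>x. \<forall>n. cantor_digit q x (Suc n) = E (Suc n)"
proof -
  define W where "W = (\<lambda>n i. \<Prod>t<i. 1 / real (q (Suc (n + t))))"
  define R where "R = (\<lambda>n. \<Sum>i. real (E (Suc (n + i))) * W n (Suc i))"
  have qpos: "real (q n) > 0" for n using q[of n] by simp
  have W0: "W n i \<ge> 0" for n i unfolding W_def by (intro prod_nonneg) auto
  have term_le: "real (E (Suc (n + i))) * W n (Suc i) \<le> W n i - W n (Suc i)" for n i
  proof -
    \<comment> \<open>Digits at most \<open>q - 1\<close> are dominated by a telescoping sum; this
      gives only \<open>R n \<le> 1\<close>.\<close>
    have "real (E (Suc (n + i))) * W n (Suc i) \<le> (real (q (Suc (n + i))) - 1) * W n (Suc i)"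
      using E[of "Suc (n + i)"] W0 by (intro mult_right_mono) auto
    also have "\<dots> = W n i - W n (Suc i)" using qpos[of "Suc (n + i)"] by (simp add: W_def field_simps)
    finally show ?thesis .
  qed
  have partial: "(\<Sum>i<N. real (E (Suc (n + i))) * W n (Suc i)) \<le> 1" for n N
  proof -
    have "(\<Sum>i<N. real (E (Suc (n + i))) * W n (Suc i)) \<le> (\<Sum>i<N. W n i - W n (Suc i))"
      by (intro sum_mono term_le)
    also have "\<dots> = W n 0 - W n N" by (rule sum_lessThan_telescope')
    also have "\<dots> \<le> 1" using W0[of n N] by (simp add: W_def)
    finally show ?thesis .
  qed
  have summ: "summable (\<lambda>i. real (E (Suc (n + i))) * W n (Suc i))" for n
    using W0 partial by (intro summableI_nonneg_bounded) auto
  have R0: "0 \<le> R n" for n unfolding R_def using W0 by (intro suminf_nonneg summ) auto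
  have R1: "R n \<le> 1" for n unfolding R_def by (intro suminf_le_const summ partial)
  have rec: "real (q (Suc n)) * R n = real (E (Suc n)) + R (Suc n)" for n
  proof -
    have shift: "W n (Suc i) = W (Suc n) i / real (q (Suc n))" for i
      unfolding W_def by (subst prod.lessThan_Suc_shift) simp
    have "R n = (\<Sum>i. real (E (Suc (n + Suc i))) * W n (Suc (Suc i))) + real (E (Suc n)) * W n (Suc 0)"
      unfolding R_def using suminf_split_head[OF summ[of n]] by simp
    also have "(\<Sum>i. real (E (Suc (n + Suc i))) * W n (Suc (Suc i))) = R (Suc n) / real (q (Suc n))"
      unfolding R_def shift[of "Suc _"] using suminf_divide[OF summ[of "Suc n"], of "real (q (Suc n))"] by simp
    finally show ?thesis using qpos[of "Suc n"] by (simp add: W_def field_simps)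
  qed
  \<comment> \<open>Strictness comes from the digits being at most \<open>q - 2\<close>: one unit of
    slack absorbs \<open>R (Suc n) \<le> 1\<close>.\<close>
  have R1': "R n < 1" for n
  proof -
    have "real (q (Suc n)) * R n \<le> real (q (Suc n)) - 1"
      unfolding rec using E[of "Suc n"] R1[of "Suc n"] by linarith
    then have "real (q (Suc n)) * R n < real (q (Suc n)) * 1" by simp
    then show ?thesis using qpos[of "Suc n"] by (simp only: mult_less_cancel_left_pos)
  qed
  have T: "T_Q q n (R 0) = R n" for n
  proof (induction n)
    case 0 then show ?case using R0[of 0] R1'[of 0] by (simp add: T_Q_def qprod_def frac_eq)
  next
    case (Suc n)
    then have "T_Q q (Suc n) (R 0) = frac (real (E (Suc n)) + R (Suc n))" by (simp add: T_Q_Suc rec)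
    also have "\<dots> = R (Suc n)"
      using R0[of "Suc n"] R1'[of "Suc n"] by (simp add: frac_unique_iff)
    finally show ?case .
  qed
  have "cantor_digit q (R 0) (Suc n) = E (Suc n)" for n
    using T_Q_digit[of q n "R 0"] unfolding T rec by simp
  then show ?thesis by blast
qed

section \<open>Small digits of integer multiples\<close>

text \<open>A digit \<open>e\<close> of \<open>x\<close> to base \<open>b\<close> can produce a digit \<open>0\<close> or \<open>1\<close> of \<open>m x\<close> with \<open>m \<le> r\<close> only
  if \<open>e / b\<close> is close to some \<open>i / m\<close>; those \<open>e\<close> with \<open>0 < i < m\<close> are collected here.\<close>

definition near_fractions :: "nat \<Rightarrow> nat \<Rightarrow> nat set" where
  "near_fractions r b = (\<Union>m\<in>{2..r}. \<Union>i\<in>{1..<m}. {i * b div m, i * b div m + 1})"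

lemma finite_near_fractions: "finite (near_fractions r b)"
  by (simp add: near_fractions_def)

lemma card_near_fractions: "card (near_fractions r b) \<le> 2 * r\<^sup>2"
proof -
  have "card (near_fractions r b) \<le> (\<Sum>m\<in>{2..r}. card (\<Union>i\<in>{1..<m}. {i * b div m, i * b div m + 1}))"
    unfolding near_fractions_def by (rule card_UN_le) simp
  also have "\<dots> \<le> (\<Sum>m\<in>{2..r}. 2 * r)"
  proof (rule sum_mono)
    fix m assume m: "m \<in> {2..r}"
    have "card (\<Union>i\<in>{1..<m}. {i * b div m, i * b div m + 1}) \<le> (\<Sum>i\<in>{1..<m}. card {i * b div m, i * b div m + 1})"
      by (rule card_UN_le) simp
    also have "\<dots> \<le> (\<Sum>i\<in>{1..<m}. 2)" by (intro sum_mono) (simp add: card_insert_if)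
    also have "\<dots> \<le> 2 * r" using m by (simp, linarith)
    finally show "card (\<Union>i\<in>{1..<m}. {i * b div m, i * b div m + 1}) \<le> 2 * r" .
  qed
  also have "\<dots> = (r - 1) * (2 * r)" by simp
  also have "\<dots> \<le> r * (2 * r)" by (intro mult_right_mono) auto
  also have "\<dots> = 2 * r\<^sup>2" by (simp add: power2_eq_square)
  finally show ?thesis .
qed

text \<open>The smallest fraction involved is \<open>1 / r\<close>, so only large digits are
  affected; fixed small digits survive when \<open>b div r\<close> is large.\<close>

lemma near_fractions_ge:
  assumes "e \<in> near_fractions r b" shows "b div r \<le> e"
proof -
  obtain m i where "m \<in> {2..r}" "i \<in> {1..<m}" "e \<in> {i * b div m, i * b div m + 1}"
    using assms unfolding near_fractions_def by blast
  then have mi: "2 \<le> m" "m \<le> r" "1 \<le> i" "i * b div m \<le> e" by auto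
  have "b div r \<le> b div m" using mi by (intro div_le_mono2) auto
  also have "\<dots> \<le> i * b div m" using mi by (intro div_le_mono) auto
  finally show ?thesis using mi by linarith
qed

text \<open>With \<open>e\<close>, \<open>b\<close>, \<open>t'\<close>, \<open>i\<close>,
  \<open>s\<close> as in the proof, the digit recursions of \<open>x\<close> and \<open>m x\<close>
  combine to \<open>d + s = m * e + m * t' - i * b\<close>. Since \<open>d + s < 2\<close> and
  \<open>0 \<le> m * t' < m\<close>, this pins \<open>e\<close> to \<open>i * b div m\<close> or its
  successor. Avoidance excludes \<open>0 < i < m\<close>, and \<open>i = 0\<close> leaves
  \<open>m * e < 2\<close>, hence \<open>e = 0\<close>.\<close>

lemma digit_of_multiple:
  fixes m d :: nat
  assumes m: "2 \<le> m" "m \<le> r" and d: "d < 2"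
    and avoid: "cantor_digit q x (Suc n) \<notin> near_fractions r (q (Suc n))"
    and digit: "cantor_digit q (real m * x) (Suc n) = d"
  shows "cantor_digit q x (Suc n) = 0" and "\<lfloor>real m * T_Q q (Suc n) x\<rfloor> = int d"
proof -
  define e where "e = cantor_digit q x (Suc n)"
  define b where "b = q (Suc n)"
  define t where "t = T_Q q n x"
  define t' where "t' = T_Q q (Suc n) x"
  define i where "i = nat \<lfloor>real m * t\<rfloor>"
  have t: "0 \<le> t" "t < 1" "0 \<le> t'" "t' < 1" using T_Q_bounds unfolding t_def t'_def by auto
  have bt: "real b * t = real e + t'" using T_Q_digit[of q n x] by (simp add: e_def b_def t_def t'_def)
  have fl: "real i = of_int \<lfloor>real m * t\<rfloor>" using t by (simp add: i_def)
  have "real m * t < real m" using t m by simp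
  then have im: "i < m" using fl by linarith
  have "T_Q q n (real m * x) = real m * t - real i"
    using T_Q_of_int_mult[of q n "int m" x] by (simp add: t_def frac_def fl)
  then have "real (cantor_digit q (real m * x) (Suc n)) + T_Q q (Suc n) (real m * x) = real b * (real m * t - real i)"
    using T_Q_digit[of q n "real m * x"] by (simp add: b_def)
  moreover have "real b * (real m * t - real i) = real m * real e + real m * t' - real (i * b)"
    using arg_cong[OF bt, of "\<lambda>y. real m * y"] by (simp add: algebra_simps)
  ultimately have eq: "real d + T_Q q (Suc n) (real m * x) = real m * real e + real m * t' - real (i * b)"
    using digit by simp
  define s where "s = T_Q q (Suc n) (real m * x)"
  have s: "0 \<le> s" "s < 1" using T_Q_bounds unfolding s_def by auto
  have mt': "0 \<le> real m * t'" "real m * t' < real m" using t m by auto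
  have "real (m * e) < real (i * b + 2)" using eq mt' s d unfolding s_def[symmetric] by (simp; linarith)
  then have up: "m * e < i * b + 2" by linarith
  have "real (i * b) < real (m * e + m)" using eq mt' s unfolding s_def[symmetric] by (simp; linarith)
  then have lo: "i * b < m * e + m" by linarith
  have "i = 0"
  proof (rule ccontr)
    assume "i \<noteq> 0"
    have "i * b div m \<le> e"
    proof -
      have "i * b div m < Suc e" using lo m by (subst div_less_iff_less_mult) (auto simp: mult.commute)
      then show ?thesis by simp
    qed
    moreover have "e \<le> i * b div m + 1"
    proof -
      have "e * m \<le> i * b + 1 * m" using up m by (simp add: mult.commute)
      then have "e \<le> (i * b + 1 * m) div m" using m by (subst less_eq_div_iff_mult_less_eq) auto
      then show ?thesis using m by simp
    qed
    ultimately have "e \<in> {i * b div m, i * b div m + 1}" by auto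
    then have "e \<in> near_fractions r b"
      using m im \<open>i \<noteq> 0\<close> unfolding near_fractions_def
      by (intro UN_I[of m] UN_I[of i]) auto
    with avoid show False by (simp add: e_def b_def)
  qed
  then have "m * e < 2" using up by simp
  moreover have "m * e \<ge> 2" if "e \<noteq> 0"
    using m that mult_le_mono[of 2 m 1 e] by simp
  ultimately have "e = 0" by fastforce
  then show "cantor_digit q x (Suc n) = 0" by (simp add: e_def)
  have "real m * t' = real d + s" using eq \<open>e = 0\<close> \<open>i = 0\<close> by (simp add: s_def)
  then show "\<lfloor>real m * T_Q q (Suc n) x\<rfloor> = int d"
    using s by (simp add: t'_def[symmetric] floor_eq_iff)
qed

lemma Q_k_nonneg: "0 \<le> Q_k q k N"
  unfolding Q_k_def by (intro sum_nonneg divide_nonneg_nonneg prod_nonneg) auto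

text \<open>From some place \<open>K\<close> on, \<open>m \<le> r n\<close> and
  \<open>digit_of_multiple\<close> applies. The first \<open>K\<close> places change a block count
  by at most \<open>K\<close>, which is negligible against the divergent
  \<open>Q_k q j\<close>.\<close>

lemma multiple_not_Q_normal_order:
  fixes m :: nat
  assumes r: "filterlim r at_top sequentially" and rq: "\<And>n. r n \<le> q n"
    and avoid: "\<And>n. cantor_digit q x (Suc n) \<notin> near_fractions (r (Suc n)) (q (Suc n))"
    and m: "2 \<le> m" and j: "1 \<le> j" and div: "k_divergent q j"
    and normal: "j = 1 \<Longrightarrow> Q_normal_order q 1 x"
  shows "\<not> Q_normal_order q j (real m * x)"
proof
  assume nm: "Q_normal_order q j (real m * x)"
  have "eventually (\<lambda>n. m \<le> r n) sequentially" using r by (simp add: filterlim_at_top)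
  then obtain K where K: "\<And>n. n \<ge> K \<Longrightarrow> m \<le> r n" by (auto simp: eventually_sequentially)
  have digit: "cantor_digit q x n = 0 \<and> \<lfloor>real m * T_Q q n x\<rfloor> = int d"
    if "n \<ge> 1" "n > K" "d < 2" "cantor_digit q (real m * x) n = d" for n d
  proof -
    obtain n' where n': "n = Suc n'" using \<open>n \<ge> 1\<close> by (cases n) auto
    show ?thesis
      using digit_of_multiple[of m "r n" d q x n'] that m K[of n] avoid[of n'] unfolding n' by auto
  qed
  have lim0: "(\<lambda>n. real K / Q_k q j n) \<longlonglongrightarrow> 0"
    using div unfolding k_divergent_def by (rule tendsto_divide_0[OF tendsto_const filterlim_at_top_imp_at_infinity])
  show False
  proof (cases "j = 1")
    case True
    \<comment> \<open>Both digits \<open>0\<close> and \<open>1\<close> of \<open>m x\<close> come from digit \<open>0\<close> of \<open>x\<close>, which is only half as frequent as required.\<close>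
    have bc: "block_count q [d] y N = card {i \<in> {1..N}. cantor_digit q y i = d}" for d y N
      by (simp add: block_count_def)
    have le: "block_count q [0] (real m * x) N + block_count q [1] (real m * x) N \<le> K + block_count q [0] x N" for N
    proof -
      have "block_count q [0] (real m * x) N + block_count q [1] (real m * x) N
          = card ({i \<in> {1..N}. cantor_digit q (real m * x) i = 0} \<union> {i \<in> {1..N}. cantor_digit q (real m * x) i = 1})"
        unfolding bc by (subst card_Un_disjoint) auto
      also have "\<dots> \<le> card ({1..K} \<union> {i \<in> {1..N}. cantor_digit q x i = 0})"
        using digit[of _ 0] digit[of _ 1] by (intro card_mono) force+
      also have "\<dots> \<le> card {1..K} + block_count q [0] x N" unfolding bc by (rule card_Un_le)
      finally show ?thesis by simp
    qed
    have "real (block_count q [0] (real m * x) N) / Q_k q j N + real (block_count q [1] (real m * x) N) / Q_k q j N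
        \<le> real K / Q_k q j N + real (block_count q [0] x N) / Q_k q j N" for N
      unfolding add_divide_distrib[symmetric] of_nat_add[symmetric]
      by (intro divide_right_mono of_nat_mono le Q_k_nonneg)
    moreover have "(\<lambda>N. real (block_count q [0] (real m * x) N) / Q_k q j N
        + real (block_count q [1] (real m * x) N) / Q_k q j N) \<longlonglongrightarrow> 1 + 1"
      using nm True unfolding Q_normal_order_def by (intro tendsto_add) auto
    moreover have "(\<lambda>N. real K / Q_k q j N + real (block_count q [0] x N) / Q_k q j N) \<longlonglongrightarrow> 0 + 1"
      using lim0 normal[OF True] True unfolding Q_normal_order_def by (intro tendsto_add) auto
    ultimately have "1 + 1 \<le> (0 + 1 :: real)" by (intro LIMSEQ_le) auto
    then show False by simp
  next
    case False
    \<comment> \<open>A digit \<open>1\<close> of \<open>m x\<close> forces \<open>T_Q q n x \<ge> 1 / m\<close>, so the next digit of \<open>x\<close> cannot be \<open>0\<close>.\<close>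
    define B where "B = 1 # replicate (j - 1) (0::nat)"
    have B: "length B = j" "B ! 0 = 1" "B ! 1 = 0" using j False by (auto simp: B_def)
    have "block_count q B (real m * x) N \<le> K" for N
    proof -
      have "{i \<in> {1..N}. \<forall>t<length B. cantor_digit q (real m * x) (i + t) = B ! t} \<subseteq> {1..K}"
      proof
        fix i assume i: "i \<in> {i \<in> {1..N}. \<forall>t<length B. cantor_digit q (real m * x) (i + t) = B ! t}"
        have d: "cantor_digit q (real m * x) i = 1" "cantor_digit q (real m * x) (Suc i) = 0"
          using i B j False by (auto dest: spec[of _ 0] spec[of _ 1])
        have "\<not> K < i"
        proof
          assume "K < i"
          then have one: "\<lfloor>real m * T_Q q i x\<rfloor> = 1" and zero: "cantor_digit q x (Suc i) = 0"
            using digit[of i 1] digit[of "Suc i" 0] d i by auto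
          \<comment> \<open>As \<open>m \<le> q (Suc i)\<close>, a digit 0 at place
            \<open>Suc i\<close> bounds \<open>T_Q q i x\<close> below \<open>1 / m\<close>, so the
            carry into place \<open>i\<close> would be 0 instead of 1.\<close>
          have "real m \<le> real (q (Suc i))" using K[of "Suc i"] rq[of "Suc i"] \<open>K < i\<close> by simp
          then have "real m * T_Q q i x \<le> real (q (Suc i)) * T_Q q i x"
            using T_Q_bounds by (intro mult_right_mono) auto
          also have "\<dots> < 1" using T_Q_digit[of q i x] T_Q_bounds[of q "Suc i" x] zero by simp
          finally show False using one by linarith
        qed
        then show "i \<in> {1..K}" using i by simp
      qed
      then have "card {i \<in> {1..N}. \<forall>t<length B. cantor_digit q (real m * x) (i + t) = B ! t} \<le> card {1..K}"
        by (intro card_mono) auto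
      then show ?thesis by (simp add: block_count_def)
    qed
    then have "(\<lambda>N. real (block_count q B (real m * x) N) / Q_k q j N) \<longlonglongrightarrow> 0"
      using Q_k_nonneg by (intro tendsto_sandwich[OF _ _ tendsto_const lim0]) (auto intro!: always_eventually divide_right_mono)
    moreover have "(\<lambda>N. real (block_count q B (real m * x) N) / Q_k q j N) \<longlonglongrightarrow> 1"
      using nm B unfolding Q_normal_order_def by blast
    ultimately show False using LIMSEQ_unique by fastforce
  qed
qed

section \<open>Random digits\<close>

text \<open>An averaging argument of Stolz-Cesaro type: the terms up to \<open>K\<close> contribute
  a constant \<open>C\<close>, which the divergent denominator absorbs, and later terms have
  relative error at most \<open>e/2\<close>.\<close>

lemma sum_ratio_tendsto_1:
  fixes a b :: "nat \<Rightarrow> real"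
  assumes ratio: "(\<lambda>n. a n / b n) \<longlonglongrightarrow> 1"
    and pos: "\<And>n. n \<ge> 1 \<Longrightarrow> b n > 0"
    and div: "filterlim (\<lambda>N. \<Sum>n=1..N. b n) at_top sequentially"
  shows "(\<lambda>N. (\<Sum>n=1..N. a n) / (\<Sum>n=1..N. b n)) \<longlonglongrightarrow> 1"
proof (rule LIMSEQ_I)
  fix e :: real assume e: "e > 0"
  from LIMSEQ_D[OF ratio, of "e/2"] e obtain K0 where
    K0: "\<And>n. n \<ge> K0 \<Longrightarrow> norm (a n / b n - 1) < e/2" by auto
  define K where "K = Suc K0"
  have K: "\<bar>a n - b n\<bar> \<le> e/2 * b n" if "n \<ge> K" for n
  proof -
    have b: "b n > 0" using pos that by (auto simp: K_def)
    have "\<bar>a n - b n\<bar> = \<bar>a n / b n - 1\<bar> * b n"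
      using b by (simp add: field_simps flip: abs_mult_pos)
    also have "\<dots> \<le> e/2 * b n" using K0[of n] that b by (intro mult_right_mono) (auto simp: K_def)
    finally show ?thesis .
  qed
  define C where "C = (\<Sum>n=1..K. \<bar>a n - b n\<bar>)"
  have bound: "\<bar>(\<Sum>n=1..N. a n) - (\<Sum>n=1..N. b n)\<bar> \<le> C + e/2 * (\<Sum>n=1..N. b n)" for N
  proof -
    have "\<bar>(\<Sum>n=1..N. a n) - (\<Sum>n=1..N. b n)\<bar> \<le> (\<Sum>n=1..N. \<bar>a n - b n\<bar>)"
      by (simp add: sum_subtractf[symmetric] sum_abs)
    also have "\<dots> \<le> (\<Sum>n=1..N. (if n \<le> K then \<bar>a n - b n\<bar> else 0) + e/2 * b n)"
    proof (rule sum_mono)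
      fix n assume "n \<in> {1..N}"
      then show "\<bar>a n - b n\<bar> \<le> (if n \<le> K then \<bar>a n - b n\<bar> else 0) + e/2 * b n"
        using K[of n] pos[of n] e by auto
    qed
    also have "\<dots> = (\<Sum>n=1..N. (if n \<le> K then \<bar>a n - b n\<bar> else 0)) + e/2 * (\<Sum>n=1..N. b n)"
      by (simp add: sum.distrib sum_distrib_left)
    also have "(\<Sum>n=1..N. (if n \<le> K then \<bar>a n - b n\<bar> else 0)) = (\<Sum>n\<in>{1..N} \<inter> {..K}. \<bar>a n - b n\<bar>)"
      by (subst sum.inter_restrict) auto
    also have "\<dots> \<le> C" unfolding C_def by (intro sum_mono2) auto
    finally show ?thesis by simp
  qed
  \<comment> \<open>Above \<open>2 * C / e\<close> the constant \<open>C\<close> is less than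
    \<open>e/2\<close> times the denominator; the bound 1 keeps the denominator positive.\<close>
  have "eventually (\<lambda>N. (\<Sum>n=1..N. b n) > max 1 (2 * C / e)) sequentially"
    using div unfolding filterlim_at_top_dense by blast
  then obtain N0 where N0: "\<And>N. N \<ge> N0 \<Longrightarrow> (\<Sum>n=1..N. b n) > max 1 (2 * C / e)"
    by (auto simp: eventually_sequentially)
  show "\<exists>no. \<forall>n\<ge>no. norm ((\<Sum>n=1..n. a n) / (\<Sum>n=1..n. b n) - 1) < e"
  proof (intro exI allI impI)
    fix N assume "N \<ge> N0"
    then have B: "(\<Sum>n=1..N. b n) > 1" "(\<Sum>n=1..N. b n) > 2 * C / e" using N0[of N] by auto
    have "\<bar>(\<Sum>n=1..N. a n) / (\<Sum>n=1..N. b n) - 1\<bar>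
        = \<bar>(\<Sum>n=1..N. a n) - (\<Sum>n=1..N. b n)\<bar> / (\<Sum>n=1..N. b n)"
    proof -
      have "(\<Sum>n=1..N. a n) / (\<Sum>n=1..N. b n) - 1
          = ((\<Sum>n=1..N. a n) - (\<Sum>n=1..N. b n)) / (\<Sum>n=1..N. b n)"
        using B by (simp add: diff_divide_distrib)
      then show ?thesis using B by (simp add: abs_divide)
    qed
    also have "\<dots> \<le> (C + e/2 * (\<Sum>n=1..N. b n)) / (\<Sum>n=1..N. b n)"
      using bound[of N] B by (intro divide_right_mono) auto
    also have "\<dots> < e" using B e by (simp add: field_simps)
    finally show "norm ((\<Sum>n=1..N. a n) / (\<Sum>n=1..N. b n) - 1) < e" by simp
  qed
qed

lemma filterlim_at_top_of_ratio:
  fixes a b :: "nat \<Rightarrow> real"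
  assumes "(\<lambda>n. a n / b n) \<longlonglongrightarrow> 1" and "filterlim b at_top sequentially"
  shows "filterlim a at_top sequentially"
proof -
  have "filterlim (\<lambda>n. a n / b n * b n) at_top sequentially"
    by (rule filterlim_tendsto_pos_mult_at_top[OF assms(1) _ assms(2)]) simp
  moreover have "eventually (\<lambda>n. b n > 0) sequentially"
    using assms(2) by (simp add: filterlim_at_top_dense)
  then have "eventually (\<lambda>n. a n / b n * b n = a n) sequentially"
    by eventually_elim simp
  ultimately show ?thesis by (simp cong: filterlim_cong)
qed

lemma ratio_tendsto_1_trans:
  fixes a b c :: "nat \<Rightarrow> real"
  assumes "(\<lambda>n. a n / b n) \<longlonglongrightarrow> 1" "(\<lambda>n. b n / c n) \<longlonglongrightarrow> 1"
  shows "(\<lambda>n. a n / c n) \<longlonglongrightarrow> 1"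
proof -
  have lim: "(\<lambda>n. (a n / b n) * (b n / c n)) \<longlonglongrightarrow> 1"
    using tendsto_mult[OF assms] by simp
  \<comment> \<open>Positivity of the quotient forces \<open>b n \<noteq> 0\<close>, which permits
    the cancellation.\<close>
  have "eventually (\<lambda>n. b n / c n > 0) sequentially"
    using order_tendstoD(1)[OF assms(2), of 0] by simp
  then have "eventually (\<lambda>n. (a n / b n) * (b n / c n) = a n / c n) sequentially"
    by eventually_elim (auto simp: zero_less_divide_iff)
  with lim show ?thesis by (rule Lim_transform_eventually)
qed

section \<open>Uniform distribution from the leading digits\<close>

text \<open>The ratio of digit \<open>n + 1\<close> to \<open>q (n + 1)\<close> lies below
  \<open>T_Q q n x\<close> by less than \<open>1 / q (n + 1)\<close>, which tends to 0. Rational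
  thresholds suffice by density and keep the family of required events countable.\<close>

lemma Q_distribution_normal_if_digits_equidistributed:
  assumes q: "filterlim q at_top sequentially"
    and digits: "\<And>a::rat. 0 < a \<Longrightarrow> a < 1 \<Longrightarrow>
      (\<lambda>N. real (card {n \<in> {1..N}. real (cantor_digit q x n) / real (q n) < of_rat a}) / real N) \<longlonglongrightarrow> of_rat a"
  shows "Q_distribution_normal q x"
proof -
  define G where "G = (\<lambda>a N. card {n \<in> {1..N}. real (cantor_digit q x n) / real (q n) < of_rat a})"
  define D where "D = (\<lambda>y N. card {n. n < N \<and> T_Q q n x < y})"
  have G_shift: "G a N = card {n. n < N \<and> real (cantor_digit q x (Suc n)) / real (q (Suc n)) < of_rat a}" for a N
    unfolding G_def
    by (rule bij_betw_same_card[where f = "\<lambda>n. n - 1"], rule bij_betw_byWitness[where f' = Suc]) auto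
  have "eventually (\<lambda>n. 1 \<le> q n) sequentially" using q by (simp add: filterlim_at_top)
  then obtain K1 where K1: "\<And>n. n \<ge> K1 \<Longrightarrow> 1 \<le> q n" by (auto simp: eventually_sequentially)
  have K_lim: "(\<lambda>N. real K / real N) \<longlonglongrightarrow> 0" for K :: nat by real_asymp
  have Dlim: "(\<lambda>N. real (D y N) / real N) \<longlonglongrightarrow> y" if y: "0 \<le> y" "y \<le> 1" for y
  proof (rule LIMSEQ_I)
    fix e :: real assume e: "e > 0"
    \<comment> \<open>For \<open>y < 1\<close> take a rational \<open>a\<close> slightly above
      \<open>y\<close>: apart from finitely many \<open>n\<close>, \<open>T_Q q n x < y\<close> puts
      the digit ratio below \<open>a\<close>. At \<open>y = 1\<close> the trivial bound
      \<open>D y N \<le> N\<close> is enough.\<close>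
    have upper: "eventually (\<lambda>N. real (D y N) / real N < y + e) sequentially"
    proof (cases "y < 1")
      case True
      then obtain a where a: "y < of_rat a" "of_rat a < min 1 (y + e / 2)"
        using of_rat_dense[of y "min 1 (y + e / 2)"] e by auto
      have "0 < (of_rat a :: real)" "(of_rat a :: real) < 1" using a y by linarith+
      then have "0 < a" "a < 1" by (simp_all add: zero_less_of_rat_iff of_rat_less_1_iff)
      then have "(\<lambda>N. real (G a N) / real N + real K1 / real N) \<longlonglongrightarrow> of_rat a + 0"
        unfolding G_def by (intro tendsto_add digits K_lim)
      then have "eventually (\<lambda>N. real (G a N) / real N + real K1 / real N < y + e) sequentially"
        using a e by (intro order_tendstoD) auto
      then show ?thesis
      proof eventually_elim
        case (elim N)
        have "D y N \<le> G a N + K1"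
        proof -
          have "real (cantor_digit q x (Suc n)) / real (q (Suc n)) < of_rat a" if "T_Q q n x < y" "n \<ge> K1" for n
          proof -
            have "real (cantor_digit q x (Suc n)) \<le> T_Q q n x * real (q (Suc n))"
              using T_Q_digit[of q n x] T_Q_bounds[of q "Suc n" x] by (simp add: mult.commute)
            then have "real (cantor_digit q x (Suc n)) / real (q (Suc n)) \<le> T_Q q n x"
              using K1[of "Suc n"] that by (intro mult_imp_div_pos_le) auto
            then show ?thesis using that a by linarith
          qed
          then have "{n. n < N \<and> T_Q q n x < y}
              \<subseteq> {n. n < N \<and> real (cantor_digit q x (Suc n)) / real (q (Suc n)) < of_rat a} \<union> {..<K1}"
            by (auto simp: not_less)
          then have "D y N \<le> card ({n. n < N \<and> real (cantor_digit q x (Suc n)) / real (q (Suc n)) < of_rat a} \<union> {..<K1})"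
            unfolding D_def by (intro card_mono) auto
          also have "\<dots> \<le> G a N + card {..<K1}" unfolding G_shift by (rule card_Un_le)
          finally show ?thesis by simp
        qed
        then have "real (D y N) / real N \<le> (real (G a N) + real K1) / real N"
          by (intro divide_right_mono) linarith+
        then show ?case using elim by (simp add: add_divide_distrib)
      qed
    next
      case False
      have "real (D y N) / real N < y + e" for N
      proof -
        have "D y N \<le> card {..<N}" unfolding D_def by (intro card_mono) auto
        then have "real (D y N) / real N \<le> 1" by (cases "N = 0") (auto simp: divide_le_eq_1)
        then show ?thesis using False e by linarith
      qed
      then show ?thesis by simp
    qed
    have lower: "eventually (\<lambda>N. y - e < real (D y N) / real N) sequentially"
    proof (cases "0 < y")
      case True
      then obtain a where a: "max 0 (y - e / 2) < of_rat a" "of_rat a < y"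
        using of_rat_dense[of "max 0 (y - e / 2)" y] e by auto
      have "0 < (of_rat a :: real)" "(of_rat a :: real) < 1" using a y by linarith+
      then have "0 < a" "a < 1" by (simp_all add: zero_less_of_rat_iff of_rat_less_1_iff)
      \<comment> \<open>Chosen so that \<open>1 / q n < y - a\<close>: the gap between digit ratio
        and remainder then cannot carry \<open>T_Q\<close> from below \<open>a\<close> up to
        \<open>y\<close>.\<close>
      have "eventually (\<lambda>n. nat \<lceil>1 / (y - of_rat a)\<rceil> + 1 \<le> q n) sequentially"
        using q by (simp only: filterlim_at_top)
      then obtain K where K: "\<And>n. n \<ge> K \<Longrightarrow> nat \<lceil>1 / (y - of_rat a)\<rceil> + 1 \<le> q n"
        by (auto simp: eventually_sequentially)
      have "(\<lambda>N. real (G a N) / real N - real K / real N) \<longlonglongrightarrow> of_rat a - 0"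
        unfolding G_def using \<open>0 < a\<close> \<open>a < 1\<close> by (intro tendsto_diff digits K_lim)
      then have "eventually (\<lambda>N. y - e < real (G a N) / real N - real K / real N) sequentially"
        using a e by (intro order_tendstoD) auto
      then show ?thesis
      proof eventually_elim
        case (elim N)
        have "G a N \<le> D y N + K"
        proof -
          have "T_Q q n x < y"
            if n: "real (cantor_digit q x (Suc n)) / real (q (Suc n)) < of_rat a" "n \<ge> K" for n
          proof -
            have "1 / (y - of_rat a) < real (q (Suc n))" using K[of "Suc n"] n by linarith
            moreover have "0 < 1 / (y - of_rat a)" using a by simp
            ultimately have qn: "real (q (Suc n)) > 0" by linarith
            have "1 < (y - of_rat a) * real (q (Suc n))"
              using \<open>1 / (y - of_rat a) < real (q (Suc n))\<close> a by (simp add: pos_divide_less_eq mult.commute)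
            moreover have "real (cantor_digit q x (Suc n)) < of_rat a * real (q (Suc n))"
              using n qn by (simp add: pos_divide_less_eq)
            moreover have "real (q (Suc n)) * T_Q q n x < real (cantor_digit q x (Suc n)) + 1"
              using T_Q_digit[of q n x] T_Q_bounds[of q "Suc n" x] by linarith
            ultimately have "real (q (Suc n)) * T_Q q n x < real (q (Suc n)) * y"
              by (simp add: algebra_simps)
            then show ?thesis using qn by (simp only: mult_less_cancel_left_pos)
          qed
          then have "{n. n < N \<and> real (cantor_digit q x (Suc n)) / real (q (Suc n)) < of_rat a}
              \<subseteq> {n. n < N \<and> T_Q q n x < y} \<union> {..<K}"
            by (auto simp: not_less)
          then have "G a N \<le> card ({n. n < N \<and> T_Q q n x < y} \<union> {..<K})"
            unfolding G_shift by (intro card_mono) auto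
          also have "\<dots> \<le> D y N + card {..<K}" unfolding D_def by (rule card_Un_le)
          finally show ?thesis by simp
        qed
        then have "(real (G a N) - real K) / real N \<le> real (D y N) / real N"
          by (intro divide_right_mono) linarith+
        then show ?case using elim by (simp add: diff_divide_distrib)
      qed
    next
      case False
      then have "y - e < 0" using e by linarith
      then have "y - e < real (D y N) / real N" for N by (rule less_le_trans) simp
      then show ?thesis by simp
    qed
    from upper lower have "eventually (\<lambda>N. norm (real (D y N) / real N - y) < e) sequentially"
      by eventually_elim (simp add: abs_less_iff)
    then show "\<exists>no. \<forall>N\<ge>no. norm (real (D y N) / real N - y) < e" by (simp add: eventually_sequentially)
  qed
  show ?thesis
    unfolding Q_distribution_normal_def unif_distr_mod1_def
  proof (intro allI impI, elim conjE)
    fix a b :: real assume ab: "0 \<le> a" "a < b" "b \<le> 1"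
    have frac: "frac (T_Q q n x) = T_Q q n x" for n using T_Q_bounds by (simp add: frac_eq)
    have "real (card {n. n < N \<and> a \<le> frac (T_Q q n x) \<and> frac (T_Q q n x) < b}) = real (D b N) - real (D a N)" for N
    proof -
      have "{n. n < N \<and> a \<le> T_Q q n x \<and> T_Q q n x < b} = {n. n < N \<and> T_Q q n x < b} - {n. n < N \<and> T_Q q n x < a}"
        using ab by auto
      moreover have "{n. n < N \<and> T_Q q n x < a} \<subseteq> {n. n < N \<and> T_Q q n x < b}" using ab by auto
      ultimately show ?thesis unfolding frac D_def
        by (simp add: card_Diff_subset of_nat_diff card_mono)
    qed
    moreover have "(\<lambda>N. real (D b N) / real N - real (D a N) / real N) \<longlonglongrightarrow> b - a"
      using ab by (intro tendsto_diff Dlim) auto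
    ultimately show "(\<lambda>N. real (card {n. n < N \<and> a \<le> frac (T_Q q n x) \<and> frac (T_Q q n x) < b}) / real N) \<longlonglongrightarrow> b - a"
      by (simp add: diff_divide_distrib)
  qed
qed

section \<open>Admissible digits and their frequencies\<close>

text \<open>Ensures that digit 0 always remains available, so that no set of admissible digits is
  empty.\<close>

lemma zero_notin_near_fractions:
  assumes "r \<le> b" shows "0 \<notin> near_fractions r b"
proof
  assume 0: "0 \<in> near_fractions r b"
  then have "2 \<le> r" by (auto simp: near_fractions_def)
  then show False using near_fractions_ge[OF 0] div_le_mono[OF assms, of r] by simp
qed

text \<open>\<open>A n\<close> is the set of digits allowed at place \<open>n\<close>. The digit
  \<open>q n - 1\<close> is dropped as well, to leave the slack that
  \<open>exists_cantor_digits\<close> requires. The cube in \<open>r_cube\<close> makes the removed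
  digits, of order \<open>r n ^ 2\<close> in number, a vanishing proportion of
  \<open>q n\<close>.\<close>

locale sparse_digits =
  fixes q r :: "nat \<Rightarrow> nat" and A :: "nat \<Rightarrow> nat set"
  assumes q: "\<And>n. 2 \<le> q n" and q_top: "filterlim q at_top sequentially"
    and r_cube: "\<And>n. r n ^ 3 \<le> q n" and r_top: "filterlim r at_top sequentially"
  defines "A \<equiv> \<lambda>n. {..<q n - 1} - near_fractions (r n) (q n)"
begin

lemma r_le: "r n \<le> q n"
proof -
  have "r n \<le> r n ^ 3" by (cases "r n = 0") (auto intro: self_le_power)
  then show ?thesis using r_cube[of n] by linarith
qed

lemma finite_A: "finite (A n)" and zero_in_A: "0 \<in> A n"
  using q[of n] zero_notin_near_fractions[OF r_le[of n]] by (auto simp: A_def)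

text \<open>Once \<open>b < r n\<close>, the cubic bound gives \<open>b < q n div r n\<close>, below
  every removed fraction digit.\<close>

lemma eventually_in_A: "eventually (\<lambda>n. b \<in> A n) sequentially"
proof -
  have "eventually (\<lambda>n. b + 2 \<le> q n) sequentially" "eventually (\<lambda>n. b + 1 \<le> r n) sequentially"
    using q_top r_top by (simp_all add: filterlim_at_top)
  then show ?thesis
  proof eventually_elim
    case (elim n)
    have "(b + 1) * r n \<le> r n * r n" using elim by (intro mult_right_mono) auto
    also have "\<dots> \<le> r n ^ 3" using elim by (simp add: power3_eq_cube)
    also have "\<dots> \<le> q n" by (rule r_cube)
    finally have "b + 1 \<le> q n div r n" using elim by (subst less_eq_div_iff_mult_less_eq) auto
    then have "b \<notin> near_fractions (r n) (q n)" using near_fractions_ge[of b "r n" "q n"] by auto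
    then show ?case using elim by (auto simp: A_def)
  qed
qed

text \<open>The numerator bounds the total counting error: \<open>2 * r^2\<close> for digits near
  fractions, 1 for \<open>q n - 1\<close>, and 1 for rounding a threshold to an integer.\<close>

lemma excluded_ratio: "(\<lambda>n. (2 * real (r n) ^ 2 + 2) / real (q n)) \<longlonglongrightarrow> 0"
proof (rule tendsto_sandwich[OF _ _ tendsto_const])
  have "filterlim (\<lambda>n. real (r n)) at_top sequentially"
    by (rule filterlim_compose[OF filterlim_real_sequentially r_top])
  then have "(\<lambda>n. 4 / real (r n)) \<longlonglongrightarrow> 0"
    by (intro tendsto_divide_0[OF tendsto_const] filterlim_at_top_imp_at_infinity)
  then show "(\<lambda>n. 4 / real (r n)) \<longlonglongrightarrow> 0" .
  have "eventually (\<lambda>n. 1 \<le> r n) sequentially" using r_top by (simp add: filterlim_at_top)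
  then show "eventually (\<lambda>n. (2 * real (r n) ^ 2 + 2) / real (q n) \<le> 4 / real (r n)) sequentially"
  proof eventually_elim
    case (elim n)
    have "1 \<le> real (r n) ^ 2" using elim by (intro one_le_power) auto
    then have "2 * real (r n) ^ 2 + 2 \<le> 4 * real (r n) ^ 2" by simp
    moreover have "real (r n) ^ 3 \<le> real (q n)" using r_cube[of n] by (metis of_nat_le_iff of_nat_power)
    ultimately have "(2 * real (r n) ^ 2 + 2) / real (q n) \<le> 4 * real (r n) ^ 2 / real (r n) ^ 3"
      using elim by (intro frac_le) auto
    also have "\<dots> = 4 / real (r n)" using elim by (simp add: power2_eq_square power3_eq_cube)
    finally show ?case .
  qed
qed auto

text \<open>Before removal the digits below the threshold number \<open>a * q n\<close> up to
  rounding; removal changes this by an amount negligible by \<open>excluded_ratio\<close>.\<close>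

lemma card_A_initial:
  assumes "0 \<le> a" "a \<le> 1"
  shows "(\<lambda>n. real (card (A n \<inter> {e. real e / real (q n) < a})) / real (q n)) \<longlonglongrightarrow> a"
proof -
  have bounds: "\<bar>real (card (A n \<inter> {e. real e / real (q n) < a})) - a * real (q n)\<bar> \<le> 2 * real (r n) ^ 2 + 2" for n
  proof -
    define C where "C = {e. real e / real (q n) < a}"
    have qn: "real (q n) > 0" using q[of n] by simp
    have C: "C = {..<nat \<lceil>a * real (q n)\<rceil>}"
    proof -
      have "real e / real (q n) < a \<longleftrightarrow> e < nat \<lceil>a * real (q n)\<rceil>" for e
        using qn by (simp add: pos_divide_less_eq) linarith
      then show ?thesis by (auto simp: C_def)
    qed
    have "0 \<le> a * real (q n)" using assms by simp
    then have cardC: "a * real (q n) \<le> real (card C)" "real (card C) \<le> a * real (q n) + 1"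
      unfolding C by (simp; linarith)+
    have Cq: "C \<subseteq> {..<q n}"
    proof
      fix e assume "e \<in> C"
      then have "real e / real (q n) < 1" using assms by (simp add: C_def)
      then show "e \<in> {..<q n}" using qn by simp
    qed
    then have finC: "finite C" by (rule finite_subset) simp
    have "card C \<le> card (A n \<inter> C) + card ({q n - 1} \<union> near_fractions (r n) (q n))"
    proof -
      have "C \<subseteq> (A n \<inter> C) \<union> ({q n - 1} \<union> near_fractions (r n) (q n))"
        using Cq q[of n] by (fastforce simp: A_def)
      then have "card C \<le> card ((A n \<inter> C) \<union> ({q n - 1} \<union> near_fractions (r n) (q n)))"
        using finC by (intro card_mono) (auto simp: finite_near_fractions)
      also have "\<dots> \<le> card (A n \<inter> C) + card ({q n - 1} \<union> near_fractions (r n) (q n))" by (rule card_Un_le)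
      finally show ?thesis .
    qed
    also have "card ({q n - 1} \<union> near_fractions (r n) (q n)) \<le> 1 + 2 * (r n)\<^sup>2"
      using card_Un_le[of "{q n - 1}" "near_fractions (r n) (q n)"] card_near_fractions[of "r n" "q n"] by simp
    finally have "card C \<le> card (A n \<inter> C) + (1 + 2 * (r n)\<^sup>2)" by simp
    then have "real (card C) \<le> real (card (A n \<inter> C) + (1 + 2 * (r n)\<^sup>2))" by (rule of_nat_mono)
    moreover have "card (A n \<inter> C) \<le> card C" using finC by (intro card_mono) auto
    then have "real (card (A n \<inter> C)) \<le> real (card C)" by (rule of_nat_mono)
    moreover have "0 \<le> real (r n) ^ 2" by simp
    ultimately have "\<bar>real (card (A n \<inter> C)) - a * real (q n)\<bar> \<le> 2 * real (r n) ^ 2 + 2"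
      using cardC unfolding abs_le_iff of_nat_add of_nat_mult of_nat_power of_nat_1 of_nat_numeral by linarith
    then show ?thesis unfolding C_def .
  qed
  have "(\<lambda>n. real (card (A n \<inter> {e. real e / real (q n) < a})) / real (q n) - a) \<longlonglongrightarrow> 0"
  proof (rule tendsto_rabs_zero_cancel, rule tendsto_sandwich[OF _ _ tendsto_const excluded_ratio])
    show "eventually (\<lambda>n. \<bar>real (card (A n \<inter> {e. real e / real (q n) < a})) / real (q n) - a\<bar>
        \<le> (2 * real (r n) ^ 2 + 2) / real (q n)) sequentially"
    proof (intro always_eventually allI)
      fix n
      have qn: "real (q n) > 0" using q[of n] by simp
      have "real (card (A n \<inter> {e. real e / real (q n) < a})) / real (q n) - a
          = (real (card (A n \<inter> {e. real e / real (q n) < a})) - a * real (q n)) / real (q n)"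
        using qn by (simp add: diff_divide_distrib)
      then show "\<bar>real (card (A n \<inter> {e. real e / real (q n) < a})) / real (q n) - a\<bar>
        \<le> (2 * real (r n) ^ 2 + 2) / real (q n)"
        using bounds[of n] qn by (simp add: abs_divide divide_right_mono)
    qed
  qed auto
  then show ?thesis by (simp add: LIM_zero_iff)
qed

lemma card_A_ratio: "(\<lambda>n. real (card (A n)) / real (q n)) \<longlonglongrightarrow> 1"
proof -
  have "A n \<inter> {e. real e / real (q n) < 1} = A n" for n
    using q[of n] by (auto simp: A_def)
  then show ?thesis using card_A_initial[of 1] by simp
qed

lemma digit_probability:
  assumes "0 \<le> a" "a \<le> 1"
  shows "(\<lambda>n. real (card (A n \<inter> {e. real e / real (q n) < a})) / real (card (A n))) \<longlonglongrightarrow> a"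
proof -
  have "(\<lambda>n. (real (card (A n \<inter> {e. real e / real (q n) < a})) / real (q n)) / (real (card (A n)) / real (q n))) \<longlonglongrightarrow> a / 1"
    by (intro tendsto_divide card_A_initial card_A_ratio assms) simp
  moreover have "q n \<noteq> 0" for n using q[of n] by simp
  ultimately show ?thesis by simp
qed

text \<open>For large \<open>n\<close> all entries of \<open>B\<close> are admissible, so each
  factor of the probability is \<open>1 / card (A (n + t))\<close>; comparison with
  \<open>1 / q (n + t)\<close> is \<open>card_A_ratio\<close>.\<close>

lemma block_probability:
  "(\<lambda>n. (\<Prod>t<length B. real (card (A (n + t) \<inter> {B ! t})) / real (card (A (n + t))))
     / (1 / (\<Prod>t<length B. real (q (n + t))))) \<longlonglongrightarrow> 1"
proof -
  have "(\<lambda>n. \<Prod>t<length B. 1 / (real (card (A (n + t))) / real (q (n + t)))) \<longlonglongrightarrow> (\<Prod>t<length B. 1 / 1)"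
    by (intro tendsto_prod tendsto_divide tendsto_const LIMSEQ_ignore_initial_segment card_A_ratio) simp
  then have lim: "(\<lambda>n. \<Prod>t<length B. 1 / (real (card (A (n + t))) / real (q (n + t)))) \<longlonglongrightarrow> 1" by simp
  have "eventually (\<lambda>n. \<forall>t\<in>{..<length B}. B ! t \<in> A (n + t)) sequentially"
    by (intro eventually_ball_finite ballI) (auto simp: eventually_in_A eventually_sequentially_seg[where P = "\<lambda>n. _ \<in> A n"])
  then have "eventually (\<lambda>n. (\<Prod>t<length B. 1 / (real (card (A (n + t))) / real (q (n + t))))
      = (\<Prod>t<length B. real (card (A (n + t) \<inter> {B ! t})) / real (card (A (n + t))))
     / (1 / (\<Prod>t<length B. real (q (n + t))))) sequentially"
    by eventually_elim (auto simp: prod_dividef)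
  with lim show ?thesis by (rule Lim_transform_eventually)
qed

end

lemma (in sparse_digits) exists_normal_number:
  "\<exists>x. (\<forall>j. k_divergent q j \<longrightarrow> Q_normal_order q j x) \<and> Q_distribution_normal q x \<and>
       (\<forall>n. cantor_digit q x (Suc n) \<in> A (Suc n))"
proof -
  \<comment> \<open>One countable index type serves both goals: lists are blocks, for normality, and
    rationals are thresholds on windows of length one, for distribution normality.\<close>
  define J :: "nat list + rat \<Rightarrow> nat" where "J = case_sum length (\<lambda>_. 1)"
  define C :: "nat list + rat \<Rightarrow> nat \<Rightarrow> nat \<Rightarrow> nat set"
    where "C = case_sum (\<lambda>B n t. {B ! t}) (\<lambda>a n t. {e. real e / real (q n) < of_rat a})"
  define \<pi> where "\<pi> = (\<lambda>k n. \<Prod>t<J k. real (card (A (n + t) \<inter> C k n t)) / real (card (A (n + t))))"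
  have "\<And>n. A n \<noteq> {}" using zero_in_A by auto
  then have "\<exists>\<omega>. (\<forall>n. \<omega> n \<in> A n) \<and>
    (\<forall>k. filterlim (\<lambda>N. \<Sum>n=1..N. \<pi> k n) at_top sequentially \<longrightarrow>
        (\<lambda>N. real (card {n \<in> {1..N}. \<forall>t<J k. \<omega> (n + t) \<in> C k n t}) / (\<Sum>n=1..N. \<pi> k n)) \<longlonglongrightarrow> 1)"
    unfolding \<pi>_def by (rule exists_generic_sequence[OF finite_A])
  then obtain \<omega> where generic: "(\<forall>n. \<omega> n \<in> A n) \<and>
    (\<forall>k. filterlim (\<lambda>N. \<Sum>n=1..N. \<pi> k n) at_top sequentially \<longrightarrow>
        (\<lambda>N. real (card {n \<in> {1..N}. \<forall>t<J k. \<omega> (n + t) \<in> C k n t}) / (\<Sum>n=1..N. \<pi> k n)) \<longlonglongrightarrow> 1)" ..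
  note \<omega>A = generic[THEN conjunct1, rule_format]
  note \<omega> = generic[THEN conjunct2, rule_format]
  have "\<omega> n + 2 \<le> q n" for n using \<omega>A[of n] q[of n] by (auto simp: A_def)
  from exists_cantor_digits[of q \<omega>, OF q this]
  obtain x where x: "\<And>n. cantor_digit q x (Suc n) = \<omega> (Suc n)" by blast
  then have x': "cantor_digit q x n = \<omega> n" if "n \<ge> 1" for n using that by (cases n) auto
  have "Q_normal_order q j x" if div: "k_divergent q j" for j
    unfolding Q_normal_order_def
  proof (intro allI impI)
    fix B :: "nat list" assume B: "length B = j"
    have Q: "Q_k q j = (\<lambda>N. \<Sum>n=1..N. 1 / (\<Prod>t<length B. real (q (n + t))))"
      by (simp add: Q_k_def B fun_eq_iff)
    have pos: "0 < 1 / (\<Prod>t<length B. real (q (n + t)))" for n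
      using q by (intro divide_pos_pos prod_pos) (auto intro: less_le_trans[of 0 2])
    \<comment> \<open>Genericity compares block counts with the exact expectation; this ratio allows
      \<open>Q_k q j\<close> to take its place.\<close>
    have ratio: "(\<lambda>N. (\<Sum>n=1..N. \<pi> (Inl B) n) / Q_k q j N) \<longlonglongrightarrow> 1"
      unfolding Q using div pos block_probability[of B] unfolding k_divergent_def Q
      by (intro sum_ratio_tendsto_1) (simp_all add: \<pi>_def J_def C_def)
    have "filterlim (\<lambda>N. \<Sum>n=1..N. \<pi> (Inl B) n) at_top sequentially"
      using filterlim_at_top_of_ratio[OF ratio] div by (simp add: k_divergent_def)
    from \<omega>[OF this] have "(\<lambda>N. real (card {n \<in> {1..N}. \<forall>t<J (Inl B). \<omega> (n + t) \<in> C (Inl B) n t}) / Q_k q j N) \<longlonglongrightarrow> 1"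
      using ratio by (rule ratio_tendsto_1_trans)
    moreover have "{n \<in> {1..N}. \<forall>t<J (Inl B). \<omega> (n + t) \<in> C (Inl B) n t}
        = {i \<in> {1..N}. \<forall>t<length B. cantor_digit q x (i + t) = B ! t}" for N
      using x' by (auto simp: J_def C_def)
    ultimately show "(\<lambda>n. real (block_count q B x n) / Q_k q j n) \<longlonglongrightarrow> 1"
      by (simp add: block_count_def)
  qed
  moreover have "Q_distribution_normal q x"
  proof (rule Q_distribution_normal_if_digits_equidistributed[OF q_top])
    fix a :: rat assume a: "0 < a" "a < 1"
    define b :: real where "b = of_rat a"
    have b: "0 < b" "b < 1" using a by (simp_all add: b_def zero_less_of_rat_iff of_rat_less_1_iff)
    have "\<pi> (Inr a) = (\<lambda>n. real (card (A n \<inter> {e. real e / real (q n) < b})) / real (card (A n)))"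
      by (simp add: \<pi>_def J_def C_def b_def fun_eq_iff)
    then have "\<pi> (Inr a) \<longlonglongrightarrow> b" using digit_probability[of b] b by simp
    then have "(\<lambda>n. \<pi> (Inr a) n / b) \<longlonglongrightarrow> b / b" using b by (intro tendsto_divide tendsto_const) auto
    then have r1: "(\<lambda>n. \<pi> (Inr a) n / b) \<longlonglongrightarrow> 1" using b by simp
    have top: "filterlim (\<lambda>N. \<Sum>n=1..N. b) at_top sequentially" using b by simp real_asymp
    have ratio: "(\<lambda>N. (\<Sum>n=1..N. \<pi> (Inr a) n) / (\<Sum>n=1..N. b)) \<longlonglongrightarrow> 1"
      by (rule sum_ratio_tendsto_1[OF r1 _ top]) (use b in auto)
    from \<omega>[OF filterlim_at_top_of_ratio[OF ratio top]]
    have "(\<lambda>N. real (card {n \<in> {1..N}. \<forall>t<J (Inr a). \<omega> (n + t) \<in> C (Inr a) n t}) / (\<Sum>n=1..N. b)) \<longlonglongrightarrow> 1"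
      using ratio by (rule ratio_tendsto_1_trans)
    moreover have "{n \<in> {1..N}. \<forall>t<J (Inr a). \<omega> (n + t) \<in> C (Inr a) n t}
        = {n \<in> {1..N}. real (cantor_digit q x n) / real (q n) < of_rat a}" for N
      using x' by (auto simp: J_def C_def)
    ultimately have "(\<lambda>N. real (card {n \<in> {1..N}. real (cantor_digit q x n) / real (q n) < of_rat a}) / (real N * b)) \<longlonglongrightarrow> 1"
      by simp
    then have "(\<lambda>N. b * (real (card {n \<in> {1..N}. real (cantor_digit q x n) / real (q n) < of_rat a}) / (real N * b))) \<longlonglongrightarrow> b * 1"
      by (intro tendsto_mult tendsto_const)
    then show "(\<lambda>N. real (card {n \<in> {1..N}. real (cantor_digit q x n) / real (q n) < of_rat a}) / real N) \<longlonglongrightarrow> of_rat a"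
      using b by (simp add: b_def)
  qed
  ultimately show ?thesis using \<omega>A by (intro exI[of _ x]) (simp add: x)
qed

section \<open>Modifying finitely many terms\<close>

lemma exists_cube_root_sequence:
  assumes "filterlim (q :: nat \<Rightarrow> nat) at_top sequentially"
  obtains r :: "nat \<Rightarrow> nat" where "\<And>n. r n ^ 3 \<le> q n" "filterlim r at_top sequentially"
proof
  define r where "r = (\<lambda>n. nat \<lfloor>root 3 (real (q n))\<rfloor>)"
  show "r n ^ 3 \<le> q n" for n
  proof -
    have "real (r n) \<le> root 3 (real (q n))" by (simp add: r_def)
    then have "real (r n) ^ 3 \<le> root 3 (real (q n)) ^ 3" by (intro power_mono) auto
    then have "real (r n ^ 3) \<le> real (q n)" by simp
    then show ?thesis by linarith
  qed
  show "filterlim r at_top sequentially"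
    unfolding filterlim_at_top
  proof
    fix Z
    have "eventually (\<lambda>n. Z ^ 3 \<le> q n) sequentially" using assms by (simp add: filterlim_at_top)
    then show "eventually (\<lambda>n. Z \<le> r n) sequentially"
    proof eventually_elim
      case (elim n)
      then have "real Z ^ 3 \<le> real (q n)" by (metis of_nat_le_iff of_nat_power)
      then have "root 3 (real Z ^ 3) \<le> root 3 (real (q n))" by simp
      then have "real Z \<le> root 3 (real (q n))" by (simp add: real_root_power_cancel)
      then show ?case by (simp add: r_def le_nat_floor)
    qed
  qed
qed

text \<open>Block counts are integers, so their ratio to a value in \<open>[0, 3/4]\<close> is \<open>0\<close> (also when dividing by \<open>0\<close>) or at least \<open>4/3\<close>.\<close>

lemma not_Q_normal_order_if_Q_k_small:
  assumes "\<And>N. Q_k q j N \<le> 3/4"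
  shows "\<not> Q_normal_order q j y"
proof
  define B where "B = replicate j (0::nat)"
  assume "Q_normal_order q j y"
  then have "(\<lambda>n. real (block_count q B y n) / Q_k q j n) \<longlonglongrightarrow> 1"
    by (simp add: Q_normal_order_def B_def)
  from LIMSEQ_D[OF this, of "1/4"]
  obtain N where N: "\<bar>real (block_count q B y N) / Q_k q j N - 1\<bar> < 1/4" by fastforce
  define c where "c = block_count q B y N"
  show False
  proof (cases "c = 0 \<or> Q_k q j N = 0")
    case True then show False using N by (auto simp: c_def)
  next
    case False
    then have "4/3 * Q_k q j N \<le> real c" using assms[of N] by linarith
    then have "4/3 \<le> real c / Q_k q j N" using False Q_k_nonneg[of q j N] by (simp add: pos_le_divide_eq)
    then show False using N unfolding c_def by linarith
  qed
qed

lemma incseq_Q_k: "incseq (Q_k q k)"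
proof (rule incseq_SucI)
  show "Q_k q k n \<le> Q_k q k (Suc n)" for n
    unfolding Q_k_def by (simp add: prod_nonneg)
qed

lemma Q_k_antimono:
  assumes q: "\<And>n. n \<ge> 1 \<Longrightarrow> 1 \<le> q n" and "i \<le> j" shows "Q_k q j N \<le> Q_k q i N"
  unfolding Q_k_def
proof (intro sum_mono frac_le)
  fix n assume n: "n \<in> {1..N}"
  show "0 < (\<Prod>t<i. real (q (n + t)))"
    using q n by (intro prod_pos) (auto simp: Suc_le_eq)
  show "(\<Prod>t<i. real (q (n + t))) \<le> (\<Prod>t<j. real (q (n + t)))"
  proof (rule prod_mono2)
    show "1 \<le> real (q (n + t))" for t using q[of "n + t"] n by simp
  qed (use assms in auto)
qed auto

lemma k_divergent_antimono:
  assumes "k_divergent q j" "i \<le> j" and q: "\<And>n. n \<ge> 1 \<Longrightarrow> 1 \<le> q n"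
  shows "k_divergent q i"
  using assms(1) unfolding k_divergent_def
  by (rule filterlim_at_top_mono) (simp add: Q_k_antimono[OF q assms(2)])

text \<open>A block starting after \<open>K\<close> involves only indices above \<open>K\<close>, so
  all later summands agree.\<close>

lemma Q_k_tail_eq:
  assumes "\<And>n. K < n \<Longrightarrow> q n = p n" "K \<le> N"
  shows "Q_k q k N - Q_k q k K = Q_k p k N - Q_k p k K"
proof -
  have split: "Q_k f k N = Q_k f k K + (\<Sum>n\<in>{K<..N}. 1 / (\<Prod>t<k. real (f (n + t))))" for f
    unfolding Q_k_def using assms(2)
    by (subst sum.union_disjoint[symmetric]) (auto intro!: sum.cong)
  have "(\<Sum>n\<in>{K<..N}. 1 / (\<Prod>t<k. real (q (n + t)))) = (\<Sum>n\<in>{K<..N}. 1 / (\<Prod>t<k. real (p (n + t))))"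
    using assms(1) by (intro sum.cong refl) simp
  then show ?thesis using split[of q] split[of p] by simp
qed

lemma k_divergent_eventually_eq:
  assumes "\<And>n. K < n \<Longrightarrow> q n = p n" "k_divergent p k"
  shows "k_divergent q k"
proof -
  have "filterlim (\<lambda>N. - Q_k p k K + Q_k p k N) at_top sequentially"
    using assms(2) unfolding k_divergent_def by (rule filterlim_tendsto_add_at_top[OF tendsto_const])
  moreover have "eventually (\<lambda>N. - Q_k p k K + Q_k p k N \<le> Q_k q k N) sequentially"
  proof (rule eventually_sequentiallyI)
    fix N assume "K \<le> N"
    then show "- Q_k p k K + Q_k p k N \<le> Q_k q k N"
      using Q_k_tail_eq[of K q p N k, OF assms(1)] Q_k_nonneg[of q k K] by linarith
  qed
  ultimately show ?thesis unfolding k_divergent_def by (rule filterlim_at_top_mono)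
qed

text \<open>A monotone sequence that does not tend to infinity is bounded, hence Cauchy.\<close>

lemma exists_tail_small_if_not_k_divergent:
  assumes "\<not> k_divergent p k" "0 < e"
  obtains K where "\<And>N. K \<le> N \<Longrightarrow> Q_k p k N - Q_k p k K \<le> e"
proof -
  have "\<exists>Z. \<forall>N. Q_k p k N \<le> Z"
  proof (rule ccontr)
    assume unbounded: "\<not> ?thesis"
    have "eventually (\<lambda>N. Z \<le> Q_k p k N) sequentially" for Z
    proof -
      obtain N0 where "Z < Q_k p k N0" using unbounded by (auto simp: not_le)
      then show ?thesis
        by (intro eventually_sequentiallyI[of N0] order.trans[OF less_imp_le incseqD[OF incseq_Q_k]])
    qed
    then show False using assms(1) by (simp add: k_divergent_def filterlim_at_top)
  qed
  then obtain L where "Q_k p k \<longlonglongrightarrow> L" using incseq_convergent[OF incseq_Q_k] by metis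
  then have "Cauchy (Q_k p k)" by (rule LIMSEQ_imp_Cauchy)
  from CauchyD[OF this assms(2)]
  obtain K where K: "\<forall>m\<ge>K. \<forall>n\<ge>K. norm (Q_k p k m - Q_k p k n) < e" ..
  have "Q_k p k N - Q_k p k K \<le> e" if "K \<le> N" for N
    using K[rule_format, of N K] that by simp
  then show ?thesis by (rule that)
qed

text \<open>Only the least non-divergent order \<open>j0\<close> needs care: larger orders have
  smaller \<open>Q_k\<close>, and smaller positive orders are divergent by minimality. The bound 3/4
  splits into 1/2 for the enlarged initial terms and 1/4 for the tail.\<close>

lemma exists_finite_modification:
  assumes "basic_seq p"
  obtains q K where "\<And>n. 2 \<le> q n" "\<And>n. K < n \<Longrightarrow> q n = p n"
    "\<And>j. 1 \<le> j \<Longrightarrow> k_divergent p j \<or> (\<forall>N. Q_k q j N \<le> 3/4)"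
proof (cases "\<forall>j\<ge>1. k_divergent p j")
  case True
  \<comment> \<open>\<open>basic_seq\<close> says nothing about index 0, which therefore receives
    the value 2.\<close>
  show ?thesis
  proof (rule that[of "\<lambda>n. if n = 0 then 2 else p n" 0])
  qed (use assms True in \<open>auto simp: basic_seq_def\<close>)
next
  case False
  define j0 where "j0 = (LEAST j. 1 \<le> j \<and> \<not> k_divergent p j)"
  have j0: "1 \<le> j0" "\<not> k_divergent p j0"
    using False LeastI_ex[of "\<lambda>j. 1 \<le> j \<and> \<not> k_divergent p j"] by (auto simp: j0_def)
  have less_j0: "k_divergent p j" if "1 \<le> j" "j < j0" for j
    using not_less_Least[of j "\<lambda>j. 1 \<le> j \<and> \<not> k_divergent p j"] that by (auto simp: j0_def)
  obtain K where K: "\<And>N. K \<le> N \<Longrightarrow> Q_k p j0 N - Q_k p j0 K \<le> 1/4"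
    using exists_tail_small_if_not_k_divergent[OF j0(2), of "1/4"] by auto
  \<comment> \<open>With this value \<open>K\<close> terms contribute
    \<open>K / (2 * K + 2) \<le> 1/2\<close> at order 1, hence at most that at order
    \<open>j0\<close>.\<close>
  define q where "q = (\<lambda>n. if n \<le> K then 2 * K + 2 else p n)"
  have q2: "2 \<le> q n" for n using assms by (auto simp: q_def basic_seq_def)
  have head: "Q_k q 1 K \<le> 1/2"
  proof -
    have "Q_k q 1 K = real K / (2 * real K + 2)" by (simp add: Q_k_def q_def)
    also have "\<dots> \<le> 1/2" by (simp add: field_simps)
    finally show ?thesis .
  qed
  have small: "Q_k q j N \<le> 3/4" if "j0 \<le> j" for j N
  proof -
    have q1: "1 \<le> q n" for n using q2[of n] by linarith
    \<comment> \<open>Passing to \<open>max K N\<close> makes the tail estimate available for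
      \<open>N < K\<close> too.\<close>
    have "Q_k q j N \<le> Q_k q j (max K N)" by (intro incseqD[OF incseq_Q_k]) simp
    also have "\<dots> \<le> Q_k q j0 (max K N)" using q1 that by (rule Q_k_antimono)
    also have "\<dots> \<le> Q_k q j0 K + 1/4"
      using Q_k_tail_eq[of K q p "max K N" j0] K[of "max K N"] by (simp add: q_def)
    also have "Q_k q j0 K \<le> Q_k q 1 K" using q1 j0(1) by (rule Q_k_antimono)
    finally show ?thesis using head by linarith
  qed
  show ?thesis
  proof (rule that[of q K])
    show "k_divergent p j \<or> (\<forall>N. Q_k q j N \<le> 3/4)" if "1 \<le> j" for j
      using small less_j0[OF that] by (cases "j0 \<le> j") auto
  qed (use q2 in \<open>auto simp: q_def\<close>)
qed

lemma density_zero_if_finite: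
  assumes "finite S" shows "density_zero S"
  unfolding density_zero_def
proof (rule tendsto_sandwich[OF _ _ tendsto_const])
  show "(\<lambda>N. real (card S) / real N) \<longlonglongrightarrow> 0" by real_asymp
  show "eventually (\<lambda>N. real (card (S \<inter> {1..N})) / real N \<le> real (card S) / real N) sequentially"
    using assms by (intro always_eventually allI divide_right_mono of_nat_mono card_mono) auto
qed auto

section \<open>One sequence and one number for all orders\<close>

text \<open>The choice of \<open>q\<close> and \<open>x\<close> does not depend on an order, so it
  serves both parts of the theorem. Multiples fail at divergent orders by the digit argument and at
  the other orders because \<open>Q_k\<close> stays at most 3/4.\<close>

lemma exists_normal_number_with_abnormal_multiples:
  assumes "basic_seq p" and p_top: "infinite_in_limit p"
  obtains q x where "basic_seq q" "infinite_in_limit q" "finite {n. n \<ge> 1 \<and> p n \<noteq> q n}"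
    "\<And>j. k_divergent p j \<Longrightarrow> k_divergent q j"
    "\<And>j. k_divergent p j \<Longrightarrow> Q_normal_order q j x"
    "Q_distribution_normal q x"
    "\<And>m::int. \<And>j. 2 \<le> m \<Longrightarrow> 1 \<le> j \<Longrightarrow> \<not> Q_normal_order q j (real_of_int m * x)"
proof -
  obtain q K where
    q: "\<And>n. 2 \<le> q n" and qp: "\<And>n. K < n \<Longrightarrow> q n = p n"
    and small: "\<And>j. 1 \<le> j \<Longrightarrow> k_divergent p j \<or> (\<forall>N. Q_k q j N \<le> 3/4)"
    by (rule exists_finite_modification[OF assms(1)]) (rule that)
  have div: "k_divergent q j" if "k_divergent p j" for j
    using qp that by (rule k_divergent_eventually_eq)
  have "eventually (\<lambda>n. p n = q n) sequentially"
    using qp by (intro eventually_sequentiallyI[of "Suc K"]) simp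
  then have q_top: "filterlim q at_top sequentially"
    using p_top unfolding infinite_in_limit_def by (simp cong: filterlim_cong)
  obtain r where r: "\<And>n. r n ^ 3 \<le> q n" "filterlim r at_top sequentially"
    by (rule exists_cube_root_sequence[OF q_top]) (rule that)
  interpret sparse_digits q r "\<lambda>n. {..<q n - 1} - near_fractions (r n) (q n)"
    by unfold_locales (use q q_top r in auto)
  obtain x where x: "\<And>j. k_divergent q j \<Longrightarrow> Q_normal_order q j x" "Q_distribution_normal q x"
    "\<And>n. cantor_digit q x (Suc n) \<notin> near_fractions (r (Suc n)) (q (Suc n))"
    using exists_normal_number by blast
  show ?thesis
  proof (rule that[of q x])
    show "basic_seq q" using q by (simp add: basic_seq_def)
    show "finite {n. n \<ge> 1 \<and> p n \<noteq> q n}"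
      by (rule finite_subset[of _ "{..K}"]) (use qp in \<open>force simp: not_less[symmetric]\<close>)+
    show "\<not> Q_normal_order q j (real_of_int m * x)" if "2 \<le> m" "1 \<le> j" for m j
    proof (cases "k_divergent p j")
      case True
      then have "\<not> Q_normal_order q j (real (nat m) * x)"
        using that div[OF True] x(1)
        by (intro multiple_not_Q_normal_order[OF r(2) r_le x(3)]) auto
      then show ?thesis using that by simp
    next
      case False
      then show ?thesis using small[OF that(2)] by (intro not_Q_normal_order_if_Q_k_small) blast
    qed
  qed (use q_top div x in \<open>auto simp: infinite_in_limit_def\<close>)
qed

theorem theorem3p5:
  fixes p :: "nat \<Rightarrow> nat"
  assumes "basic_seq p" and "eventually_nondecreasing p" and "infinite_in_limit p"
  shows "(\<forall>k\<ge>1. k_divergent p k \<longrightarrow>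
            (\<exists>q :: nat \<Rightarrow> nat. \<exists>x :: real.
               basic_seq q \<and> infinite_in_limit q \<and> k_divergent q k \<and>
               density_zero {n. n \<ge> 1 \<and> p n \<noteq> q n} \<and>
               (\<forall>j\<in>{1..k}. Q_normal_order q j x) \<and>
               Q_distribution_normal q x \<and>
               (\<forall>m::int. m \<ge> 2 \<longrightarrow>
                  (\<forall>j\<ge>1. \<not> Q_normal_order q j (real_of_int m * x)))))
       \<and> (fully_divergent p \<longrightarrow>
            (\<exists>q :: nat \<Rightarrow> nat. \<exists>x :: real.
               basic_seq q \<and> infinite_in_limit q \<and> fully_divergent q \<and>
               density_zero {n. n \<ge> 1 \<and> p n \<noteq> q n} \<and>
               Q_normal q x \<and> Q_distribution_normal q x \<and>
               (\<forall>m::int. m \<ge> 2 \<longrightarrow>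
                  (\<forall>j\<ge>1. \<not> Q_normal_order q j (real_of_int m * x)))))"
proof -
  obtain q x where
    q: "basic_seq q" "infinite_in_limit q" "finite {n. n \<ge> 1 \<and> p n \<noteq> q n}"
    and div: "\<And>j. k_divergent p j \<Longrightarrow> k_divergent q j"
    and normal: "\<And>j. k_divergent p j \<Longrightarrow> Q_normal_order q j x"
    and x: "Q_distribution_normal q x"
    "\<And>m::int. \<And>j. 2 \<le> m \<Longrightarrow> 1 \<le> j \<Longrightarrow> \<not> Q_normal_order q j (real_of_int m * x)"
    by (rule exists_normal_number_with_abnormal_multiples[OF assms(1,3)]) (rule that)
  \<comment> \<open>Divergence at order \<open>k\<close> alone yields normality at all orders from 1
    to \<open>k\<close>.\<close>
  have "k_divergent p j" if "k_divergent p k" "j \<in> {1..k}" for j k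
    using assms(1) that by (intro k_divergent_antimono[of p k j]) (auto simp: basic_seq_def intro: order.trans[of _ 2])
  then show ?thesis
    using q div normal x density_zero_if_finite[OF q(3)]
    by (intro conjI allI impI exI[of _ q] exI[of _ x]) (auto simp: fully_divergent_def Q_normal_def)
qed

end
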